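(* Let $n\geq 4$ and $1\leq p \leq n-2$ be integers, and let $G$ be a connected graph with $n$ vertices of which exactly $p$ are pendant. \begin{itemize} \item If $p=1$, then $$\mathrm{N}(G) \geq \frac{n^2 + 3n - 4}{2},$$ and equality happens if and only if $G$ can be obtained (up to isomorphism) by identifying a vertex of $K_3$ with a leaf of $P_{n-2}$. \item If $p\neq 1$, then $$\mathrm{N}(G) \geq 2^p +(n-p-1)\left(2^{\lfloor p/2 \rfloor}+2^{\lceil p/2 \rceil}\right) + p+\frac{(n-p-1)(n-p-2)}{2},$$ and equality happens if and only if $G$ is isomorphic to $\mathbb{T}^1(n,p)$. \end{itemize}
   Context: All graphs are finite and simple. A pendant vertex (leaf) is a vertex of degree $1$. $\mathrm{N}(G)$ denotes the number of connected induced subgraphs of $G$, i.e. the number of nonempty subsets of $V(G)$ inducing a connected graph. $P_m$ and $S_m$ denote the path and the star on $m$ vertices, and $K_3$ is the triangle. $\mathbb{T}^1(n,p)$ is the tree of order $n$ obtained from the vertex disjoint stars $S_{1+\lfloor p/2 \rfloor}$ and $S_{1+\lceil p/2 \rceil}$ by identifying their central vertices with the two leaves of $P_{n-p}$, respectively (for $S_2$ either vertex may serve as the central vertex); in other words, $\lfloor p/2\rfloor$ pendant vertices are attached to one end of $P_{n-p}$ and $\lceil p/2\rceil$ pendant vertices are attached to the other end. *)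

theory Defs
  imports Complex_Main "Graph_Theory.Graph_Theory"
begin

text \<open>
  A finite simple graph is an element \<open>G\<close> of type \<open>'a pair_pre_digraph\<close> satisfying
  \<open>pair_graph G\<close>: an undirected edge \<open>uv\<close> is represented by the two arcs \<open>(u, v)\<close> and
  \<open>(v, u)\<close>, so the degree of a vertex is its out-degree.
\<close>

definition pendant_verts :: "('a, 'b) pre_digraph \<Rightarrow> 'a set" where
  "pendant_verts G = {v \<in> verts G. out_degree G v = 1}"

definition num_connected_induced :: "('a, 'b) pre_digraph \<Rightarrow> nat" where
  "num_connected_induced G = card {S. S \<subseteq> verts G \<and> S \<noteq> {} \<and> connected (G \<restriction> S)}"

definition path_graph :: "nat \<Rightarrow> nat pair_pre_digraph" where
  "path_graph m = \<lparr>pverts = {..<m},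
     parcs = {(i, j). i < m \<and> j < m \<and> (j = Suc i \<or> i = Suc j)}\<rparr>"

definition complete_graph :: "'a set \<Rightarrow> 'a pair_pre_digraph" where
  "complete_graph V = \<lparr>pverts = V, parcs = {(u, v). u \<in> V \<and> v \<in> V \<and> u \<noteq> v}\<rparr>"

text \<open>The star with centre \<open>c\<close> and set of leaves \<open>L\<close>; it is only meant for \<open>c \<notin> L\<close>.\<close>
definition star_graph :: "'a \<Rightarrow> 'a set \<Rightarrow> 'a pair_pre_digraph" where
  "star_graph c L = \<lparr>pverts = insert c L, parcs = {c} \<times> L \<union> L \<times> {c}\<rparr>"

text \<open>
  Identifying a vertex of one graph with a vertex of another is expressed as the union of
  two graphs whose vertex sets share precisely the identified vertex.  Below, the path on
  \<open>{..<m}\<close> has the leaves \<open>0\<close> and \<open>m - 1\<close>, and all vertices outside it are \<open>\<ge> m\<close>.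
\<close>

text \<open>For \<open>n \<ge> 4\<close>: a vertex of a triangle identified with a leaf of the path of order \<open>n - 2\<close>.\<close>
definition triangle_path :: "nat \<Rightarrow> (nat, nat \<times> nat) pre_digraph" where
  "triangle_path n = union (with_proj (path_graph (n - 2)))
     (with_proj (complete_graph {0, n - 2, n - 1}))"

text \<open>
  For \<open>p \<le> n - 2\<close>: the leaf sets of the two stars are disjoint, of sizes
  \<open>p div 2\<close> (the floor of \<open>p/2\<close>) and \<open>p - p div 2 = (p + 1) div 2\<close> (the ceiling).
\<close>
definition double_broom :: "nat \<Rightarrow> nat \<Rightarrow> (nat, nat \<times> nat) pre_digraph" where
  "double_broom n p =
     union
       (union (with_proj (path_graph (n - p)))
         (with_proj (star_graph 0 {n - p ..< n - p + p div 2})))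
       (with_proj (star_graph (n - p - 1) {n - p + p div 2 ..< n}))"

end

theory Submission
  imports Defs
begin

text \<open>
  Everything is reduced to counting connected vertex sets.  Remove the set \<open>L\<close> of the \<open>p\<close> pendant
  vertices; what remains induces a connected graph \<open>H\<close> on \<open>m = n - p\<close> vertices, and a vertex \<open>x\<close>
  of \<open>H\<close> gets as weight \<open>w x\<close> the number of pendant vertices at \<open>x\<close>.  A connected set of \<open>G\<close> is
  either a single pendant vertex or arises from a connected set \<open>S\<close> of \<open>H\<close> by adding any of the
  pendant vertices at \<open>S\<close>, so that \<open>N(G) = p + (\<Sum>S. 2 ^ w S)\<close> (\<open>card_conn_sets_leaves\<close>).

  The weighted sum is estimated as follows.  The set of all vertices contributes \<open>2 ^ p\<close>.  Consider
  the splits: connected sets whose complement is connected as well.  A split and its complement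
  together contribute \<open>2 ^ a + 2 ^ (p - a)\<close>, which is least when \<open>a\<close> is \<open>p / 2\<close>, rounded down or up,
  and there are at least \<open>m - 1\<close> such pairs (\<open>card_splits_ge\<close>), as many as a spanning tree has
  edges.  Every other connected set contributes at least \<open>1\<close>.  Since there are at least
  \<open>m (m + 1) / 2\<close> connected sets in total (\<open>card_conn_sets_ge\<close>), this adds up to the bound.  If it is
  attained, the number of connected sets is minimal, which forces \<open>H\<close> to be a path
  (\<open>path_if_few_conn_sets\<close>); an interior vertex of the path is a connected set that is not a split
  and so has weight \<open>0\<close>; and the split at an end vertex is balanced.  This is the double broom
  (\<open>weighted_equality\<close>, \<open>broom_equality\<close>).

  For \<open>p = 1\<close> this bound is not sharp.  Here one of the at least two non-cut vertices,
  say \<open>v\<close>, is not pendant and has degree at least \<open>2\<close>.  Then there are at least two connected sets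
  of every size from \<open>2\<close> to \<open>n - 1\<close> that contain \<open>v\<close> (\<open>two_rooted\<close>), hence at least \<open>2 n - 2\<close> connected
  sets through \<open>v\<close>, and at least \<open>(n - 1) n / 2\<close> that avoid \<open>v\<close>.  In case of equality \<open>G - v\<close> is a
  path, and there are exactly two connected sets of size \<open>2\<close> and of size \<open>3\<close> through \<open>v\<close>; so \<open>v\<close> is
  adjacent to precisely the first two vertices of the path (\<open>triangle_if_few_conn_sets\<close>).
\<close>

section \<open>Connected vertex sets\<close>

text \<open>
  The guaranteed number of connected \<open>k\<close>-sets through a vertex of degree at least \<open>2\<close> in a connected
  graph of order \<open>n\<close>.
\<close>
definition two_profile :: "nat \<Rightarrow> nat \<Rightarrow> nat" where
  "two_profile n k = (if 2 \<le> k \<and> k < n then 2 else 1)"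

lemma sum_two_profile: "2 \<le> n \<Longrightarrow> sum (two_profile n) {1..n} = 2 * n - 2"
proof -
  assume "2 \<le> n"
  then obtain m where n: "n = Suc (Suc m)" by (metis add_2_eq_Suc le_Suc_ex)
  have "{1..n} = insert 1 (insert n {2..<n})" by (auto simp: n)
  then have "sum (two_profile n) {1..n} = sum (two_profile n) {2..<n} + 2"
    by (simp add: n two_profile_def)
  also have "sum (two_profile n) {2..<n} = sum (\<lambda>_. 2) {2..<n}"
    by (intro sum.cong) (auto simp: two_profile_def)
  finally show ?thesis by (simp add: n)
qed

lemma card_ge_2I: "\<lbrakk>S \<noteq> T; {S, T} \<subseteq> F; finite F\<rbrakk> \<Longrightarrow> 2 \<le> card F"
  using card_mono[of F "{S,T}"] by simp

lemma card_ge_3I: "\<lbrakk>S \<noteq> T; S \<noteq> U; T \<noteq> U; {S, T, U} \<subseteq> F; finite F\<rbrakk> \<Longrightarrow> 3 \<le> card F"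
  using card_mono[of F "{S,T,U}"] by simp

locale simple_adjacency =
  fixes E :: "'a \<Rightarrow> 'a \<Rightarrow> bool"
  assumes sym: "E x y \<Longrightarrow> E y x" and irrefl: "\<not> E x x"
begin

text \<open>
  Connectedness is expressed by cuts, since all arguments below either extend a set along an edge
  that leaves it or refute connectedness by a cut without edges; \<open>conn_iff_reachable\<close> relates this to
  reachability.
\<close>
definition conn :: "'a set \<Rightarrow> bool" where
  "conn S \<longleftrightarrow> S \<noteq> {} \<and> (\<forall>A. A \<subseteq> S \<and> A \<noteq> {} \<and> A \<noteq> S \<longrightarrow> (\<exists>x\<in>A. \<exists>y\<in>S - A. E x y))"

definition conn_sets :: "'a set \<Rightarrow> 'a set set" where
  "conn_sets V = {S. S \<subseteq> V \<and> conn S}"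

definition rooted :: "'a set \<Rightarrow> 'a \<Rightarrow> 'a set set" where
  "rooted V v = {S \<in> conn_sets V. v \<in> S}"

lemma conn_sets_iff: "S \<in> conn_sets V \<longleftrightarrow> S \<subseteq> V \<and> conn S"
  by (simp add: conn_sets_def)

lemma rooted_iff: "S \<in> rooted V v \<longleftrightarrow> S \<subseteq> V \<and> conn S \<and> v \<in> S"
  by (auto simp: rooted_def conn_sets_def)

lemma finite_conn_sets [simp]: "finite V \<Longrightarrow> finite (conn_sets V)"
  by (simp add: conn_sets_def)

lemma finite_rooted [simp]: "finite V \<Longrightarrow> finite (rooted V v)"
  by (simp add: rooted_def)

lemma conn_nonempty: "conn S \<Longrightarrow> S \<noteq> {}"
  by (simp add: conn_def)

lemma not_conn_empty [simp]: "\<not> conn {}"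
  by (simp add: conn_def)

lemma conn_cut:
  assumes "conn S" "A \<subseteq> S" "A \<noteq> {}" "A \<noteq> S"
  obtains x y where "x \<in> A" "y \<in> S" "y \<notin> A" "E x y"
  using assms unfolding conn_def by (metis DiffE)

lemma conn_singleton [simp]: "conn {x}"
  by (auto simp: conn_def)

lemma conn_insert:
  assumes "conn S" "x \<in> S" "E x y"
  shows "conn (insert y S)"
  unfolding conn_def
proof (intro conjI allI impI)
  fix A assume A: "A \<subseteq> insert y S \<and> A \<noteq> {} \<and> A \<noteq> insert y S"
  show "\<exists>a\<in>A. \<exists>b\<in>insert y S - A. E a b"
  proof (cases "A \<inter> S = {} \<or> A \<inter> S = S")
    case True
    then consider "A \<subseteq> {y}" "y \<notin> S" | "S \<subseteq> A" using A by blast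
    then show ?thesis
    proof cases
      case 1
      then have "A = {y}" using A by auto
      then show ?thesis using 1 assms sym by auto
    next
      case 2
      then have "y \<notin> A" using A by auto
      then show ?thesis using 2 assms by auto
    qed
  next
    case False
    then obtain a b where "a \<in> A \<inter> S" "b \<in> S" "b \<notin> A \<inter> S" "E a b"
      using conn_cut[OF assms(1), of "A \<inter> S"] by (metis inf_le2)
    then show ?thesis by auto
  qed
qed auto

lemma conn_edge: "E x y \<Longrightarrow> conn {x, y}"
  using conn_insert[OF conn_singleton, of x x y] by (simp add: insert_commute)

text \<open>
  As long as the set is not everything, some edge leaves it, and its endpoint can be added.
\<close>
lemma conn_grow:
  assumes V: "finite V" "conn V" and S: "conn S" "S \<subseteq> V" and k: "card S \<le> k" "k \<le> card V"
  shows "\<exists>S'. S \<subseteq> S' \<and> S' \<subseteq> V \<and> conn S' \<and> card S' = k"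
  using k
proof (induction k rule: dec_induct)
  case base
  then show ?case using S by auto
next
  case (step k)
  then obtain T where T: "S \<subseteq> T" "T \<subseteq> V" "conn T" "card T = k" by auto
  then have "T \<noteq> V" using step.prems by auto
  then obtain x y where "x \<in> T" "y \<in> V" "y \<notin> T" "E x y"
    using conn_cut[OF V(2) T(2)] conn_nonempty[OF T(3)] by metis
  moreover from this have "card (insert y T) = Suc k"
    using T V finite_subset by fastforce
  ultimately show ?case using T conn_insert[OF T(3)]
    by (intro exI[of _ "insert y T"]) auto
qed

text \<open>
  Growing \<open>{u}\<close> up to all vertices but one leaves out a vertex that is not a cut vertex.
\<close>
lemma ex_noncut_vertex:
  assumes "finite V" "conn V" "u \<in> V" "card V \<ge> 2"
  shows "\<exists>v\<in>V. v \<noteq> u \<and> conn (V - {v})"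
proof -
  obtain S where S: "{u} \<subseteq> S" "S \<subseteq> V" "conn S" "card S = card V - 1"
    using conn_grow[OF assms(1,2) conn_singleton, of u "card V - 1"] assms
    by (metis One_nat_def card.empty card_insert_disjoint diff_le_self empty_iff
        empty_subsetI finite.emptyI insert_subset le_diff_conv2 nat_1_add_1 one_le_numeral order_trans)
  then have "card (V - S) = 1" using assms by (simp add: card_Diff_subset finite_subset)
  then obtain v where v: "V - S = {v}" by (auto simp: card_1_singleton_iff)
  then have "V - {v} = S" using S by auto
  then show ?thesis using S v by (intro bexI[of _ v]) auto
qed

lemma conn_nbr:
  assumes "conn V" "v \<in> V" "V \<noteq> {v}"
  obtains u where "u \<in> V" "u \<noteq> v" "E v u"
  using conn_cut[OF assms(1), of "{v}"] assms by auto

text \<open>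
  Every connected graph is built from a single vertex by attaching vertices one at a time: the last
  one is a non-cut vertex.
\<close>
lemma conn_vertex_induct [consumes 2, case_names single attach]:
  assumes "finite V" "conn V"
    and "\<And>v. P {v}"
    and "\<And>V v u. \<lbrakk>finite V; conn V; v \<notin> V; u \<in> V; E v u; conn (insert v V); P V\<rbrakk> \<Longrightarrow> P (insert v V)"
  shows "P V"
  using assms(1,2)
proof (induction "card V" arbitrary: V rule: less_induct)
  case less
  show ?case
  proof (cases "card V \<ge> 2")
    case True
    obtain w where "w \<in> V" using True by fastforce
    then obtain v where v: "v \<in> V" "conn (V - {v})"
      using ex_noncut_vertex less True by metis
    have ne: "V \<noteq> {v}" using True by auto
    obtain u where u: "u \<in> V" "u \<noteq> v" "E v u" by (rule conn_nbr[OF less(3) v(1) ne])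
    have "P (V - {v})" using less v by (meson card_Diff1_less finite_Diff)
    from assms(4)[OF _ v(2) _ _ u(3) _ this] u v less show ?thesis
      by (simp add: insert_absorb)
  next
    case False
    moreover have "card V \<noteq> 0" using less conn_nonempty by auto
    ultimately have "card V = 1" by linarith
    then show ?thesis using assms(3) by (auto simp: card_1_singleton_iff)
  qed
qed

section \<open>Connected sets through a vertex, by size\<close>

lemma card_rooted_levels:
  assumes "finite V"
  shows "card (rooted V v) = (\<Sum>k = 1..card V. card {S \<in> rooted V v. card S = k})"
proof -
  have "card S \<in> {1..card V}" if "S \<in> rooted V v" for S
    using that assms by (auto simp: rooted_iff Suc_le_eq card_gt_0_iff card_mono intro: finite_subset)
  then have "rooted V v = (\<Union>k\<in>{1..card V}. {S \<in> rooted V v. card S = k})" by auto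
  also have "card \<dots> = (\<Sum>k = 1..card V. card {S \<in> rooted V v. card S = k})"
    using assms by (intro card_UN_disjoint) auto
  finally show ?thesis .
qed

lemma rooted_level_ge1:
  assumes "finite V" "conn V" "v \<in> V" "k \<in> {1..card V}"
  shows "1 \<le> card {S \<in> rooted V v. card S = k}"
proof -
  obtain S where "S \<in> {S \<in> rooted V v. card S = k}"
    using conn_grow[OF assms(1,2) conn_singleton, of v k] assms by (auto simp: rooted_iff)
  moreover have "finite {S \<in> rooted V v. card S = k}" using assms by simp
  ultimately show ?thesis unfolding One_nat_def Suc_le_eq card_gt_0_iff by blast
qed

text \<open>
  Induction on the size.  Two connected \<open>k\<close>-sets \<open>S\<close> and \<open>T\<close> extend to connected sets of size \<open>k + 1\<close>.
  If both extensions are the same set, it is \<open>S \<union> T\<close>, and an edge leaving it leaves \<open>S\<close> or \<open>T\<close>, which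
  yields a different extension of one of them.
\<close>
lemma two_rooted:
  assumes V: "finite V" "conn V" and v: "v \<in> V" "a \<in> V" "b \<in> V" "a \<noteq> b" "E v a" "E v b"
    and k: "2 \<le> k" "k < card V"
  shows "\<exists>S T. S \<noteq> T \<and> {S, T} \<subseteq> {S \<in> rooted V v. card S = k}"
  using k
proof (induction k rule: dec_induct)
  case base
  have "v \<noteq> a" "v \<noteq> b" using v irrefl by auto
  then show ?case using v conn_edge
    by (intro exI[of _ "{v, a}"] exI[of _ "{v, b}"]) (auto simp: rooted_iff doubleton_eq_iff)
next
  case (step k)
  then obtain S T where ST: "S \<noteq> T" "{S, T} \<subseteq> {S \<in> rooted V v. card S = k}" by auto
  then have S: "S \<subseteq> V" "conn S" "v \<in> S" "card S = k" and T: "T \<subseteq> V" "conn T" "v \<in> T" "card T = k"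
    by (auto simp: rooted_iff)
  have fin: "finite S" "finite T" using S T V finite_subset by blast+
  obtain S' where S': "S \<subseteq> S'" "S' \<subseteq> V" "conn S'" "card S' = Suc k"
    using conn_grow[OF V S(2,1), of "Suc k"] S step by auto
  obtain T' where T': "T \<subseteq> T'" "T' \<subseteq> V" "conn T'" "card T' = Suc k"
    using conn_grow[OF V T(2,1), of "Suc k"] T step by auto
  show ?case
  proof (cases "S' = T'")
    case False
    then show ?thesis using S S' T T'
      by (intro exI[of _ S'] exI[of _ T']) (auto simp: rooted_iff)
  next
    case True
    have finS': "finite S'" using S' V finite_subset by blast
    \<comment> \<open>By size, a common extension is the union.\<close>
    have "S \<subset> S \<union> T" using ST S T fin by (metis Un_upper1 card_subset_eq psubsetI sup.cobounded2)
    then have "k < card (S \<union> T)" using S fin by (metis finite_UnI psubset_card_mono)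
    moreover have sub: "S \<union> T \<subseteq> S'" using S' T' True by auto
    ultimately have un: "S \<union> T = S'" using S' finS' card_mono[OF finS' sub]
      by (intro card_subset_eq) auto
    have "S' \<noteq> V" using S' step by auto
    then obtain x y where xy: "x \<in> S'" "y \<in> V" "y \<notin> S'" "E x y"
      using conn_cut[OF V(2) S'(2)] conn_nonempty[OF S'(3)] by metis
    \<comment> \<open>The edge \<open>xy\<close> leaves \<open>S \<union> T\<close>; its endpoint \<open>y\<close> can be added to the set that contains \<open>x\<close>.\<close>
    obtain R where R: "R \<in> {S, T}" "x \<in> R" using un xy by auto
    then have "conn (insert y R)" "card (insert y R) = Suc k" "insert y R \<subseteq> V" "v \<in> insert y R"
      using S T xy conn_insert[of R x y] fin un by auto
    moreover have "insert y R \<noteq> S'" using xy by auto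
    ultimately show ?thesis using S' S(3)
      by (intro exI[of _ S'] exI[of _ "insert y R"]) (auto simp: rooted_iff)
  qed
qed

text \<open>
  One connected set of every size.
\<close>
lemma rooted_ge:
  assumes "finite V" "conn V" "v \<in> V"
  shows "card V \<le> card (rooted V v)"
proof -
  have "(\<Sum>k = 1..card V. 1) \<le> card (rooted V v)"
    unfolding card_rooted_levels[OF assms(1)] by (intro sum_mono rooted_level_ge1[OF assms])
  then show ?thesis by simp
qed

text \<open>
  When the total attains the lower bound, so does the number of sets of each single size.  In the
  proofs of the equality cases a second set of some size is then a contradiction.
\<close>
lemma rooted_level_eq1:
  assumes "finite V" "conn V" "v \<in> V" "card (rooted V v) \<le> card V" "k \<in> {1..card V}"
  shows "card {S \<in> rooted V v. card S = k} = 1"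
proof -
  have "(\<Sum>k = 1..card V. 1) = (\<Sum>k = 1..card V. card {S \<in> rooted V v. card S = k})"
    using assms(4) rooted_ge[OF assms(1-3)] unfolding card_rooted_levels[OF assms(1), symmetric] by simp
  from sum_mono_inv[OF this _ assms(5)] show ?thesis using rooted_level_ge1[OF assms(1-3)] by simp
qed

lemma rooted_level_ge2:
  assumes V: "finite V" "conn V" and v: "v \<in> V" "a \<in> V" "b \<in> V" "a \<noteq> b" "E v a" "E v b"
    and k: "k \<in> {1..card V}"
  shows "two_profile (card V) k \<le> card {S \<in> rooted V v. card S = k}"
proof (cases "2 \<le> k \<and> k < card V")
  case True
  then obtain S T where "S \<noteq> T" "{S, T} \<subseteq> {S \<in> rooted V v. card S = k}"
    using two_rooted[OF V v, of k] by blast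
  moreover have "finite {S \<in> rooted V v. card S = k}" using V by simp
  ultimately have "2 \<le> card {S \<in> rooted V v. card S = k}" by (rule card_ge_2I)
  then show ?thesis using True by (simp add: two_profile_def)
next
  case False
  then show ?thesis using rooted_level_ge1[OF V v(1) k] by (auto simp: two_profile_def)
qed

lemma rooted_ge2:
  assumes V: "finite V" "conn V" and v: "v \<in> V" "a \<in> V" "b \<in> V" "a \<noteq> b" "E v a" "E v b"
  shows "2 * card V - 2 \<le> card (rooted V v)"
proof -
  have "2 \<le> card V" using v V card_ge_2I[of a b] by auto
  moreover have "sum (two_profile (card V)) {1..card V}
      \<le> (\<Sum>k = 1..card V. card {S \<in> rooted V v. card S = k})"
    by (intro sum_mono rooted_level_ge2[OF V v])
  ultimately show ?thesis
    by (metis card_rooted_levels[OF V(1)] sum_two_profile)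
qed

text \<open>
  The counterpart of \<open>rooted_level_eq1\<close> for a root of degree at least \<open>2\<close>: a third set of some
  size is a contradiction.
\<close>
lemma rooted_level_eq2:
  assumes V: "finite V" "conn V" and v: "v \<in> V" "a \<in> V" "b \<in> V" "a \<noteq> b" "E v a" "E v b"
    and le: "card (rooted V v) \<le> 2 * card V - 2" and k: "2 \<le> k" "k < card V"
  shows "card {S \<in> rooted V v. card S = k} = 2"
proof -
  have "sum (two_profile (card V)) {1..card V}
      = (\<Sum>k = 1..card V. card {S \<in> rooted V v. card S = k})"
    using le rooted_ge2[OF V v] k unfolding card_rooted_levels[OF V(1), symmetric]
    by (simp add: sum_two_profile del: One_nat_def)
  from sum_mono_inv[OF this, of k] rooted_level_ge2[OF V v] k show ?thesis
    by (simp add: two_profile_def)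
qed

lemma card_conn_sets_insert:
  assumes "finite V" "v \<notin> V"
  shows "card (conn_sets (insert v V)) = card (conn_sets V) + card (rooted (insert v V) v)"
proof -
  have "conn_sets (insert v V) = conn_sets V \<union> rooted (insert v V) v"
    by (auto simp: conn_sets_iff rooted_iff)
  moreover have "conn_sets V \<inter> rooted (insert v V) v = {}"
    using assms by (auto simp: conn_sets_iff rooted_iff)
  ultimately show ?thesis using assms by (simp add: card_Un_disjoint)
qed

text \<open>
  The vertex attached last lies in one connected set of each size.
\<close>
lemma card_conn_sets_ge:
  assumes "finite V" "conn V"
  shows "card V * (card V + 1) \<le> 2 * card (conn_sets V)"
  using assms
proof (induction V rule: conn_vertex_induct)
  case (single v)
  have "{v} \<in> conn_sets {v}" by (simp add: conn_sets_iff)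
  then have "0 < card (conn_sets {v})" by (auto simp: card_gt_0_iff)
  then show ?case by simp
next
  case (attach V v u)
  have "card (insert v V) \<le> card (rooted (insert v V) v)"
    using attach by (intro rooted_ge) auto
  then show ?case using attach card_conn_sets_insert[of V v] by simp
qed

section \<open>Paths\<close>

definition path_on :: "(nat \<Rightarrow> 'a) \<Rightarrow> 'a set \<Rightarrow> bool" where
  "path_on x V \<longleftrightarrow> bij_betw x {..<card V} V \<and>
     (\<forall>i<card V. \<forall>j<card V. E (x i) (x j) \<longleftrightarrow> j = Suc i \<or> i = Suc j)"

lemma path_on_adj: "\<lbrakk>path_on x V; i < card V; j < card V\<rbrakk> \<Longrightarrow> E (x i) (x j) \<longleftrightarrow> j = Suc i \<or> i = Suc j"
  by (simp add: path_on_def)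

lemma path_on_bij: "path_on x V \<Longrightarrow> bij_betw x {..<card V} V"
  by (simp add: path_on_def)

lemma path_on_image: "path_on x V \<Longrightarrow> x ` {..<card V} = V"
  by (simp add: path_on_def bij_betw_def)

lemma path_on_mem: "\<lbrakk>path_on x V; i < card V\<rbrakk> \<Longrightarrow> x i \<in> V"
  using path_on_image by blast

lemma path_on_inj: "\<lbrakk>path_on x V; i < card V; j < card V\<rbrakk> \<Longrightarrow> x i = x j \<longleftrightarrow> i = j"
  by (auto simp: path_on_def bij_betw_def inj_on_def)

lemma path_on_reverse:
  assumes "path_on x V"
  shows "path_on (\<lambda>i. x (card V - 1 - i)) V"
proof -
  have "bij_betw (\<lambda>i. card V - 1 - i) {..<card V} {..<card V}"
    by (rule bij_betw_byWitness[where f' = "\<lambda>i. card V - 1 - i"]) auto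
  from bij_betw_trans[OF this path_on_bij[OF assms]]
  show ?thesis using assms by (auto simp: path_on_def comp_def)
qed

lemma path_on_extend:
  assumes x: "path_on x V" and V: "finite V" "v \<notin> V"
    and adj: "\<And>i. i < card V \<Longrightarrow> E v (x i) \<longleftrightarrow> Suc i = card V"
  shows "path_on (x(card V := v)) (insert v V)"
proof -
  have "bij_betw (x(card V := v)) {..<card V} V"
    using path_on_bij[OF x] by (rule iffD2[OF bij_betw_cong, rotated]) auto
  moreover have "bij_betw (x(card V := v)) {card V} {v}" by (simp add: bij_betw_def)
  ultimately have "bij_betw (x(card V := v)) ({..<card V} \<union> {card V}) (V \<union> {v})"
    by (rule bij_betw_combine) (use V in auto)
  moreover have "E (x i) v \<longleftrightarrow> Suc i = card V" if "i < card V" for i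
    using adj[OF that] sym by blast
  ultimately show ?thesis using V adj x irrefl
    by (auto simp: path_on_def lessThan_Suc less_Suc_eq)
qed

lemma interval_conn:
  assumes x: "path_on x V" and "i \<le> j" "j < card V"
  shows "conn (x ` {i..j})"
  using assms(2,3)
proof (induction j rule: dec_induct)
  case base
  then show ?case by simp
next
  case (step j)
  then have "x j \<in> x ` {i..j}" by auto
  moreover have "E (x j) (x (Suc j))" using path_on_adj[OF x] step by simp
  ultimately have "conn (insert (x (Suc j)) (x ` {i..j}))" using step by (intro conn_insert) auto
  then show ?case using step by (simp add: atLeastAtMostSuc_conv)
qed

text \<open>
  If an index between the least and the greatest one were missing, it would separate the set, as
  edges join consecutive indices only.
\<close>
lemma conn_is_interval:
  assumes x: "path_on x V" and S: "conn S" "S \<subseteq> V"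
  obtains i j where "i \<le> j" "j < card V" "S = x ` {i..j}"
proof -
  define T where "T = {k. k < card V \<and> x k \<in> S}"
  have ST: "S = x ` T" using S(2) path_on_image[OF x] by (auto simp: T_def)
  have T: "finite T" "T \<noteq> {}" using ST conn_nonempty[OF S(1)] by (auto simp: T_def)
  define i j where "i = Min T" and "j = Max T"
  have ij: "i \<in> T" "j \<in> T" "T \<subseteq> {i..j}" using T by (auto simp: i_def j_def)
  have "k \<in> T" if k: "k \<in> {i..j}" for k
  proof (rule ccontr)
    assume kT: "k \<notin> T"
    have inj: "x a \<in> x ` B \<longleftrightarrow> a \<in> B" if "a \<in> T" "B \<subseteq> T" for a B
      using that path_on_inj[OF x] unfolding T_def by blast
    let ?B = "{t \<in> T. t < k}"
    have "i \<in> ?B" "j \<notin> ?B" using ij k kT by (auto simp: le_less)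
    then have "x j \<notin> x ` ?B" "x j \<in> S" using inj[OF ij(2), of ?B] ST ij by auto
    then have "x ` ?B \<noteq> S" by blast
    then obtain a b where ab: "a \<in> x ` ?B" "b \<in> S" "b \<notin> x ` ?B" "E a b"
      using conn_cut[OF S(1), of "x ` ?B"] \<open>i \<in> ?B\<close> ST by blast
    then obtain s t where "s \<in> T" "s < k" "t \<in> T" "\<not> t < k" "a = x s" "b = x t"
      using ST by auto
    moreover from this have "t \<noteq> k" "s < card V" "t < card V" using kT by (auto simp: T_def)
    ultimately show False using ab(4) path_on_adj[OF x, of s t] by simp
  qed
  then have "T = {i..j}" using ij by blast
  then have "S = x ` {i..j}" using ST by simp
  moreover have "j < card V" using ij(2) by (simp add: T_def)
  moreover have "i \<le> j" using ij by auto
  ultimately show ?thesis using that by blast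
qed

lemma interval_inj:
  assumes x: "path_on x V" and "i \<le> j" "j < card V" "k \<le> l" "l < card V" "x ` {i..j} = x ` {k..l}"
  shows "i = k \<and> j = l"
proof -
  have "inj_on x {..<card V}" using path_on_bij[OF x] by (simp add: bij_betw_def)
  moreover have "{i..j} \<subseteq> {..<card V}" "{k..l} \<subseteq> {..<card V}" using assms by auto
  ultimately have "{i..j} = {k..l}"
    using inj_on_image_eq_iff[of x "{..<card V}" "{i..j}" "{k..l}"] assms by auto
  then show ?thesis using assms by (auto simp: Icc_eq_Icc)
qed

lemma sum_conn_sets_path:
  assumes x: "path_on x V"
  shows "(\<Sum>S\<in>conn_sets V. f S) = (\<Sum>j<card V. \<Sum>i\<le>j. f (x ` {i..j}))"
proof -
  let ?I = "Sigma {..<card V} (\<lambda>j. {..j})"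
  have "bij_betw (\<lambda>(j, i). x ` {i..j}) ?I (conn_sets V)"
    unfolding bij_betw_def
  proof (intro conjI subset_antisym subsetI)
    show "inj_on (\<lambda>(j, i). x ` {i..j}) ?I"
      using interval_inj[OF x] by (auto simp: inj_on_def)
  next
    fix S assume "S \<in> (\<lambda>(j, i). x ` {i..j}) ` ?I"
    then show "S \<in> conn_sets V"
      using interval_conn[OF x] path_on_mem[OF x] by (auto simp: conn_sets_iff)
  next
    fix S assume "S \<in> conn_sets V"
    then obtain i j where "i \<le> j" "j < card V" "S = x ` {i..j}"
      using conn_is_interval[OF x] unfolding conn_sets_iff by metis
    then show "S \<in> (\<lambda>(j, i). x ` {i..j}) ` ?I" by force
  qed
  from sum.reindex_bij_betw[OF this, of f] show ?thesis
    by (simp add: sum.Sigma split_def)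
qed

lemma card_conn_sets_path:
  assumes "path_on x V"
  shows "2 * card (conn_sets V) = card V * (card V + 1)"
proof -
  have "card (conn_sets V) = (\<Sum>j<card V. Suc j)"
    using sum_conn_sets_path[OF assms, of "\<lambda>_. 1::nat"] by simp
  moreover have "2 * (\<Sum>j<m. Suc j) = m * (m + 1)" for m :: nat by (induction m) auto
  ultimately show ?thesis by simp
qed

text \<open>
  Induction over attaching a vertex \<open>v\<close>.  By minimality the rest is a path and there is only one
  connected set of each size through \<open>v\<close>.  So \<open>v\<close> has a single neighbour (two would already give too
  many sets), and this neighbour is an end of the path: an interior one would extend to both sides
  and give two sets of size \<open>3\<close>.
\<close>
lemma path_if_few_conn_sets:
  assumes "finite V" "conn V"
  shows "2 * card (conn_sets V) \<le> card V * (card V + 1) \<Longrightarrow> \<exists>x. path_on x V"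
  using assms
proof (induction V rule: conn_vertex_induct)
  case (single v)
  have "path_on (\<lambda>_. v) {v}" using irrefl by (auto simp: path_on_def bij_betw_def lessThan_Suc)
  then show ?case by blast
next
  case (attach V v u)
  let ?V = "insert v V"
  have V: "finite ?V" "conn ?V" "v \<in> ?V" and cV: "card ?V = Suc (card V)" using attach by auto
  have few: "2 * (card (conn_sets V) + card (rooted ?V v)) \<le> Suc (card V) * (Suc (card V) + 1)"
    using attach card_conn_sets_insert[of V v] by simp
  then have "2 * card (conn_sets V) \<le> card V * (card V + 1)" and r: "card (rooted ?V v) \<le> card ?V"
    using rooted_ge[OF V] card_conn_sets_ge[of V] attach cV by simp_all
  then obtain x where x: "path_on x V" using attach by blast
  let ?m = "card V"
  have m: "0 < ?m" using attach by (auto simp: card_gt_0_iff)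
  \<comment> \<open>Two neighbours of \<open>v\<close> would give at least \<open>2 m\<close> sets through \<open>v\<close>, but there are only \<open>m + 1\<close>.\<close>
  have uniq: "b = a" if ab: "a \<in> V" "b \<in> V" "E v a" "E v b" for a b
  proof (rule ccontr)
    assume "b \<noteq> a"
    moreover from this have "2 \<le> card V" using ab attach card_ge_2I[of a b] by auto
    ultimately show False using rooted_ge2[OF V, of a b] ab r cV by auto
  qed
  obtain i where i: "i < ?m" "u = x i" using attach path_on_image[OF x] by auto
  have adj: "E v (x j) \<longleftrightarrow> j = i" if "j < ?m" for j
    using uniq[of u "x j"] attach i that path_on_inj[OF x] path_on_mem[OF x] by auto
  have "i = 0 \<or> Suc i = ?m"
  proof (rule ccontr)
    assume "\<not> ?thesis"
    then have i': "0 < i" "Suc i < ?m" using i by auto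
    let ?S = "insert v {u, x (i - 1)}" and ?T = "insert v {u, x (Suc i)}"
    have E: "E u (x (i - 1))" "E u (x (Suc i))"
      using path_on_adj[OF x, of i "i - 1"] path_on_adj[OF x, of i "Suc i"] i i' by auto
    have mem: "x (i - 1) \<in> V" "x (Suc i) \<in> V" "u \<in> V" using path_on_mem[OF x] i i' by auto
    have ne: "x (i - 1) \<noteq> x (Suc i)" "x (i - 1) \<noteq> u" "x (Suc i) \<noteq> u"
      using path_on_inj[OF x, of "i - 1" "Suc i"] path_on_inj[OF x, of "i - 1" i]
        path_on_inj[OF x, of "Suc i" i] i i' by auto
    have vu: "E u v" using attach sym by blast
    have nv: "v \<noteq> u" "v \<noteq> x (i - 1)" "v \<noteq> x (Suc i)" using mem attach by auto
    have "conn ?S" "conn ?T" using conn_insert[OF conn_edge[OF E(1)], of u v]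
      conn_insert[OF conn_edge[OF E(2)], of u v] vu by auto
    moreover have "card ?S = 3" "card ?T = 3" using ne nv by auto
    moreover have "?S \<noteq> ?T" using ne nv by auto
    ultimately have "2 \<le> card {S \<in> rooted ?V v. card S = 3}"
      using V mem by (intro card_ge_2I[of ?S ?T]) (auto simp: rooted_iff)
    moreover have "3 \<in> {1..card ?V}" using cV i' by auto
    ultimately show False using rooted_level_eq1[OF V r, of 3] by simp
  qed
  then have "\<exists>x. path_on x V \<and> (\<forall>j<?m. E v (x j) \<longleftrightarrow> Suc j = ?m)"
  proof
    assume "i = 0"
    then show ?thesis using adj m
      by (intro exI[of _ "\<lambda>i. x (?m - 1 - i)"] conjI path_on_reverse[OF x] allI impI)
        (simp, linarith)
  next
    assume "Suc i = ?m"
    then show ?thesis using adj x by (intro exI[of _ x]) auto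
  qed
  then show ?case using path_on_extend[of _ V v] attach by blast
qed

end

section \<open>Weighted connected sets\<close>

lemma sum_mono_eqD:
  fixes f g :: "'b \<Rightarrow> real"
  assumes "sum g A \<le> sum f A" "\<And>a. a \<in> A \<Longrightarrow> f a \<le> g a" "a \<in> A" "finite A"
  shows "g a = f a"
  using sum_mono_inv[of f A g a] sum_mono[of A f g] assms by fastforce

text \<open>
  The least value of \<open>2 ^ a + 2 ^ b\<close> under the constraint \<open>a + b = p\<close>.
\<close>
definition balanced_sum :: "nat \<Rightarrow> real" where
  "balanced_sum p = 2 ^ (p div 2) + 2 ^ ((p + 1) div 2)"

lemma balanced_sum_ge2: "2 \<le> balanced_sum p"
  using two_realpow_ge_one[of "p div 2"] two_realpow_ge_one[of "(p + 1) div 2"]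
  unfolding balanced_sum_def by linarith

lemma unbalanced_gt:
  assumes "a + b = p" "a < p div 2"
  shows "balanced_sum p < 2 ^ a + 2 ^ b"
proof -
  define t where "t = p div 2 - a"
  have q: "p div 2 = a + t" and b: "b = (p + 1) div 2 + t" and t: "0 < t" and c: "a < (p + 1) div 2"
    using assms by (auto simp: t_def)
  have "(2::real) ^ a < 2 ^ ((p + 1) div 2)" using c by simp
  moreover have "(1::real) < 2 ^ t" using t by simp
  ultimately have "(2::real) ^ a * (2 ^ t - 1) < 2 ^ ((p + 1) div 2) * (2 ^ t - 1)" by simp
  then show ?thesis by (simp add: balanced_sum_def q b power_add algebra_simps)
qed

lemma balanced_sum_eq:
  assumes "a + b = p" "a = p div 2 \<or> b = p div 2"
  shows "2 ^ a + 2 ^ b = balanced_sum p"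
proof -
  have "{a, b} = {p div 2, (p + 1) div 2}" using assms by auto
  then show ?thesis using assms by (auto simp: balanced_sum_def doubleton_eq_iff)
qed

lemma unbalanced_cases:
  "a + b = p \<Longrightarrow> a < p div 2 \<or> b < p div 2 \<or> a = p div 2 \<or> b = p div 2" for p :: nat
  by linarith

lemma balanced_sum_le: "a + b = p \<Longrightarrow> balanced_sum p \<le> 2 ^ a + 2 ^ b"
  using unbalanced_cases[of a b p] unbalanced_gt[of a b p] unbalanced_gt[of b a p]
    balanced_sum_eq[of a b p]
  by (auto simp: add.commute)

lemma balanced_if_le: "\<lbrakk>a + b = p; 2 ^ a + 2 ^ b \<le> balanced_sum p\<rbrakk> \<Longrightarrow> a = p div 2 \<or> b = p div 2"
  using unbalanced_cases[of a b p] unbalanced_gt[of a b p] unbalanced_gt[of b a p]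
  by (auto simp: add.commute)

text \<open>
  The sum of \<open>2 ^ w S\<close> over the connected sets \<open>S\<close> of a path of order \<open>m\<close> whose only weights, of
  total \<open>p\<close>, are halved between its ends: the whole path, the proper initial and final segments, and
  the inner intervals.
\<close>
definition weighted_bound :: "nat \<Rightarrow> nat \<Rightarrow> real" where
  "weighted_bound m p = 2 ^ p + (real m - 1) * balanced_sum p + (real m - 1) * (real m - 2) / 2"

context simple_adjacency
begin

text \<open>
  In a tree these are the two sides of each edge.
\<close>
definition splits :: "'a set \<Rightarrow> 'a set set" where
  "splits V = {A \<in> conn_sets V. conn (V - A)}"

lemma splits_iff: "A \<in> splits V \<longleftrightarrow> A \<subseteq> V \<and> conn A \<and> conn (V - A)"
  by (auto simp: splits_def conn_sets_iff)

lemma finite_splits [simp]: "finite V \<Longrightarrow> finite (splits V)"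
  by (simp add: splits_def)

lemma splits_compl: "A \<in> splits V \<Longrightarrow> V - A \<in> splits V"
  by (auto simp: splits_iff double_diff)

text \<open>
  Attaching a vertex \<open>v\<close> with neighbour \<open>u\<close> preserves all splits, once \<open>v\<close> is put on the side of \<open>u\<close>,
  and adds the new split that separates \<open>v\<close> alone, which keeps \<open>u\<close> and \<open>v\<close> apart and so is not among
  the others.
\<close>
lemma card_splits_ge:
  assumes "finite V" "conn V"
  shows "2 * (card V - 1) \<le> card (splits V)"
  using assms
proof (induction V rule: conn_vertex_induct)
  case (single v)
  then show ?case by simp
next
  case (attach V v u)
  let ?V = "insert v V"
  \<comment> \<open>Put \<open>v\<close> on the side of \<open>u\<close>; this commutes with taking complements.\<close>
  define ext where "ext A = (if u \<in> A then insert v A else A)" for A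
  have compl: "?V - ext A = ext (V - A)" if "A \<subseteq> V" for A
    using that attach by (auto simp: ext_def)
  have ext_conn: "conn (ext A)" if "conn A" for A
    using that conn_insert[of A u v] attach sym by (auto simp: ext_def)
  have ext_sub: "ext A \<subseteq> ?V" if "A \<subseteq> V" for A using that by (auto simp: ext_def)
  have "ext ` splits V \<subseteq> splits ?V"
    using compl ext_conn ext_sub by (auto simp: splits_iff)
  moreover have "{{v}, V} \<subseteq> splits ?V"
    using attach by (auto simp: splits_iff insert_Diff_if)
  ultimately have sub: "ext ` splits V \<union> {{v}, V} \<subseteq> splits ?V" by auto
  have inj: "inj_on ext (splits V)"
  proof (rule inj_onI)
    fix A B assume "A \<in> splits V" "B \<in> splits V" "ext A = ext B"
    moreover from this have "v \<notin> A" "v \<notin> B"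
      using attach(3) by (auto simp: splits_iff)
    moreover from this have "A = ext A - {v}" "B = ext B - {v}"
      by (auto simp: ext_def)
    ultimately show "A = B" by simp
  qed
  have "u \<noteq> v" using attach by auto
  then have "{v} \<notin> ext ` splits V" "V \<notin> ext ` splits V"
    using attach(3,4) by (auto simp: ext_def splits_iff split: if_splits)
  then have "ext ` splits V \<inter> {{v}, V} = {}" by auto
  then have "card (ext ` splits V \<union> {{v}, V}) = card (splits V) + card {{v}, V}"
    using attach inj card_Un_disjoint[of "ext ` splits V" "{{v}, V}"]
    by (simp add: card_image)
  also have "{v} \<noteq> V" using attach(3) by auto
  then have "card {{v}, V} = 2" by simp
  finally have "card (splits V) + 2 \<le> card (splits ?V)"
    using card_mono[OF _ sub] attach by simp
  moreover have "0 < card V" using attach by (auto simp: card_gt_0_iff)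
  ultimately show ?case using attach by simp
qed

text \<open>
  Complementation permutes the splits.
\<close>
lemma sum_splits_twice:
  fixes w :: "'a \<Rightarrow> nat"
  assumes "finite V"
  shows "2 * (\<Sum>A\<in>splits V. (2::real) ^ sum w A) = (\<Sum>A\<in>splits V. 2 ^ sum w A + 2 ^ sum w (V - A))"
proof -
  have "bij_betw (\<lambda>A. V - A) (splits V) (splits V)"
    by (rule bij_betw_byWitness[where f' = "\<lambda>A. V - A"])
      (auto simp: splits_compl, auto simp: splits_iff)
  from sum.reindex_bij_betw[OF this, of "\<lambda>A. (2::real) ^ sum w A"]
  show ?thesis by (simp add: sum.distrib)
qed

lemma sum_split_weights:
  fixes w :: "'a \<Rightarrow> nat"
  assumes "finite V" "A \<in> splits V"
  shows "sum w A + sum w (V - A) = sum w V"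
  using assms sum.subset_diff[of A V w] by (simp add: splits_iff)

lemma conn_sets_decomp:
  assumes "finite V" "conn V"
  shows "conn_sets V = insert V (splits V \<union> (conn_sets V - splits V - {V}))"
    and "V \<notin> splits V"
  using assms by (auto simp: splits_iff conn_sets_iff)

lemma weighted_sum:
  fixes w :: "'a \<Rightarrow> nat"
  assumes V: "finite V" "conn V"
  defines "R \<equiv> conn_sets V - splits V - {V}"
  shows "(\<Sum>S\<in>conn_sets V. (2::real) ^ sum w S)
      = 2 ^ sum w V + (\<Sum>A\<in>splits V. 2 ^ sum w A + 2 ^ sum w (V - A)) / 2 + (\<Sum>S\<in>R. 2 ^ sum w S)"
    and "real (card (conn_sets V)) = 1 + real (card (splits V)) + real (card R)"
proof -
  note dec = conn_sets_decomp[OF V, folded R_def]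
  have fin: "finite (splits V)" "finite R" "splits V \<inter> R = {}" "V \<notin> R"
    using V by (auto simp: R_def)
  have "(\<Sum>S\<in>conn_sets V. f S) = f V + (\<Sum>S\<in>splits V. f S) + (\<Sum>S\<in>R. f S)" for f :: "'a set \<Rightarrow> real"
    by (subst dec(1)) (use fin dec(2) in \<open>simp add: sum.union_disjoint\<close>)
  from this[of "\<lambda>S. 2 ^ sum w S"] this[of "\<lambda>_. 1"] show
    "(\<Sum>S\<in>conn_sets V. (2::real) ^ sum w S)
      = 2 ^ sum w V + (\<Sum>A\<in>splits V. 2 ^ sum w A + 2 ^ sum w (V - A)) / 2 + (\<Sum>S\<in>R. 2 ^ sum w S)"
    "real (card (conn_sets V)) = 1 + real (card (splits V)) + real (card R)"
    using sum_splits_twice[OF V(1), of w] by simp_all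
qed

text \<open>
  These four estimates add up to \<open>weighted_bound_le\<close>; they are kept separate because equality in the
  bound forces equality in those for the splits, for the remaining sets and for the total number.
\<close>
lemma weighted_estimates:
  fixes w :: "'a \<Rightarrow> nat"
  assumes V: "finite V" "conn V" and p: "sum w V = p"
  defines "R \<equiv> conn_sets V - splits V - {V}"
  shows "real (card (splits V)) * balanced_sum p \<le> (\<Sum>A\<in>splits V. 2 ^ sum w A + 2 ^ sum w (V - A))"
    and "card R \<le> (\<Sum>S\<in>R. (2::real) ^ sum w S)"
    and "(real (card V) - 1) * (balanced_sum p - 2) \<le> card (splits V) * balanced_sum p / 2 - card (splits V)"
    and "real (card V * (card V + 1)) / 2 \<le> card (conn_sets V)"
proof -
  have "(\<Sum>A\<in>splits V. balanced_sum p) \<le> (\<Sum>A\<in>splits V. 2 ^ sum w A + 2 ^ sum w (V - A))"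
    by (intro sum_mono balanced_sum_le) (simp add: sum_split_weights V p)
  then show "card (splits V) * balanced_sum p \<le> (\<Sum>A\<in>splits V. 2 ^ sum w A + 2 ^ sum w (V - A))"
    by simp
  have "(\<Sum>S\<in>R. 1) \<le> (\<Sum>S\<in>R. (2::real) ^ sum w S)" by (intro sum_mono) simp
  then show "card R \<le> (\<Sum>S\<in>R. (2::real) ^ sum w S)" by simp
  have "real (card V) - 1 \<le> card (splits V) / 2" using card_splits_ge[OF V] by linarith
  then have "(real (card V) - 1) * (balanced_sum p - 2) \<le> card (splits V) / 2 * (balanced_sum p - 2)"
    using balanced_sum_ge2[of p] by (intro mult_right_mono) auto
  then show "(real (card V) - 1) * (balanced_sum p - 2)
      \<le> card (splits V) * balanced_sum p / 2 - card (splits V)"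
    by (simp add: field_simps)
  have "real (card V * (card V + 1)) \<le> real (2 * card (conn_sets V))"
    using card_conn_sets_ge[OF V] of_nat_mono by blast
  then show "real (card V * (card V + 1)) / 2 \<le> card (conn_sets V)" by simp
qed

text \<open>
  In this form every connected set counts \<open>1\<close>, and the whole set and the splits add their excess.
\<close>
lemma weighted_bound_alt:
  "weighted_bound m p = 2 ^ p + (real m - 1) * (balanced_sum p - 2) + real (m * (m + 1)) / 2 - 1"
  by (simp add: weighted_bound_def field_simps)

lemma weighted_bound_le:
  assumes V: "finite V" "conn V" and p: "sum w V = p"
  shows "weighted_bound (card V) p \<le> (\<Sum>S\<in>conn_sets V. 2 ^ sum w S)"
  using weighted_estimates[OF assms] weighted_sum(1)[OF V, of w] weighted_sum(2)[OF V]
  unfolding weighted_bound_alt p by linarith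

text \<open>
  Removing an end of a path leaves a path; removing an interior vertex separates the two ends.
\<close>
lemma path_splits:
  assumes x: "path_on x V" and V: "finite V" "2 \<le> card V"
  shows "{x 0} \<in> splits V" and "\<lbrakk>0 < i; Suc i < card V\<rbrakk> \<Longrightarrow> {x i} \<in> conn_sets V - splits V - {V}"
proof -
  have "V - {x 0} = x ` {1..card V - 1}"
  proof -
    have "V = x ` {..<card V}" using path_on_image[OF x] by simp
    also have "{..<card V} = insert 0 {1..card V - 1}" using V by auto
    finally have "V - {x 0} = x ` {1..card V - 1} - {x 0}" by auto
    also have "\<dots> = x ` {1..card V - 1}"
      using path_on_inj[OF x, of _ 0] V by fastforce
    finally show ?thesis .
  qed
  moreover have "conn (x ` {1..card V - 1})" using V by (intro interval_conn[OF x]) auto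
  ultimately show "{x 0} \<in> splits V" using path_on_mem[OF x, of 0] V by (auto simp: splits_iff)
next
  assume i: "0 < i" "Suc i < card V"
  have "\<not> conn (V - {x i})"
  proof
    assume "conn (V - {x i})"
    then obtain a b where ab: "a \<le> b" "b < card V" "V - {x i} = x ` {a..b}"
      using conn_is_interval[OF x] by (metis Diff_subset)
    have ne: "x 0 \<noteq> x i" "x (Suc i) \<noteq> x i"
      using path_on_inj[OF x, of 0 i] path_on_inj[OF x, of "Suc i" i] i by auto
    have mem: "x k \<in> x ` {a..b} \<longleftrightarrow> k \<in> {a..b}" if "k < card V" for k
      using path_on_inj[OF x] that ab(2) by force
    have "0 \<in> {a..b}" "Suc i \<in> {a..b}" "i \<notin> {a..b}"
      using mem[of 0] mem[of "Suc i"] mem[of i] ne ab(3) i path_on_mem[OF x] by auto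
    then show False by auto
  qed
  moreover have "{x i} \<noteq> V" using V by auto
  ultimately show "{x i} \<in> conn_sets V - splits V - {V}"
    using path_on_mem[OF x, of i] i by (auto simp: splits_iff conn_sets_iff)
qed

definition end_weighted_path :: "(nat \<Rightarrow> 'a) \<Rightarrow> 'a set \<Rightarrow> ('a \<Rightarrow> nat) \<Rightarrow> nat \<Rightarrow> nat \<Rightarrow> bool" where
  "end_weighted_path x V w a b \<longleftrightarrow> path_on x V \<and> w (x 0) = a \<and> w (x (card V - 1)) = b \<and>
     (\<forall>i. 0 < i \<and> Suc i < card V \<longrightarrow> w (x i) = 0)"

lemma sum_interval_weights:
  assumes x: "path_on x V" and "j < card V"
  shows "sum w (x ` {i..j}) = (\<Sum>k = i..j. w (x k))"
proof -
  have "inj_on x {i..j}" using assms path_on_inj[OF x] by (auto simp: inj_on_def)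
  then show ?thesis by (simp add: sum.reindex)
qed

lemma sum_end_weights:
  assumes x: "end_weighted_path x V w a b" and V: "2 \<le> card V" and ij: "i \<le> j" "j < card V"
  shows "sum w (x ` {i..j}) = (if i = 0 then a else 0) + (if Suc j = card V then b else 0)"
proof -
  have "sum w (x ` {i..j}) = (\<Sum>k = i..j. w (x k))"
    using x sum_interval_weights[of x V j] ij by (simp add: end_weighted_path_def)
  also have "\<dots> = (\<Sum>k = i..j. (if k = 0 then a else 0) + (if k = card V - 1 then b else 0))"
    using x V ij by (intro sum.cong) (auto simp: end_weighted_path_def)
  also have "\<dots> = (if i = 0 then a else 0) + (if Suc j = card V then b else 0)"
    unfolding sum.distrib using ij by (auto simp: sum.delta)
  finally show ?thesis .
qed

lemma weighted_sum_path:
  assumes x: "end_weighted_path x V w (p div 2) ((p + 1) div 2)" and V: "2 \<le> card V"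
  shows "(\<Sum>S\<in>conn_sets V. (2::real) ^ sum w S) = weighted_bound (card V) p"
proof -
  obtain k where k: "card V = Suc (Suc k)" using V by (metis add_2_eq_Suc le_Suc_ex)
  define a b where "a = p div 2" and "b = (p + 1) div 2"
  have ab: "a + b = p" by (auto simp: a_def b_def)
  have x': "path_on x V" using x by (simp add: end_weighted_path_def)
  have "(\<Sum>S\<in>conn_sets V. (2::real) ^ sum w S)
      = (\<Sum>j<card V. \<Sum>i\<le>j. 2 ^ ((if i = 0 then a else 0) + (if Suc j = card V then b else 0)))"
    unfolding sum_conn_sets_path[OF x'] a_def b_def
    by (intro sum.cong refl) (use sum_end_weights[OF x V] in auto)
  also have "\<dots> = (\<Sum>j<Suc k. \<Sum>i\<le>j. 2 ^ (if i = 0 then a else 0))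
      + (\<Sum>i\<le>Suc k. 2 ^ ((if i = 0 then a else 0) + b))"
    by (simp add: k)
  also have "(\<Sum>i\<le>Suc k. (2::real) ^ ((if i = 0 then a else 0) + b)) = 2 ^ p + (real k + 1) * 2 ^ b"
    by (subst sum.atMost_Suc_shift) (simp add: ab)
  also have "(\<Sum>j<Suc k. \<Sum>i\<le>j. (2::real) ^ (if i = 0 then a else 0)) = (\<Sum>j<Suc k. 2 ^ a + real j)"
  proof (intro sum.cong refl)
    show "(\<Sum>i\<le>j. (2::real) ^ (if i = 0 then a else 0)) = 2 ^ a + real j" for j
      by (induction j) auto
  qed
  also have "(\<Sum>j<Suc k. (2::real) ^ a + real j) = (real k + 1) * 2 ^ a + (real k + 1) * real k / 2"
    by (induction k) (auto simp: field_simps)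
  finally show ?thesis
    by (simp add: weighted_bound_def k balanced_sum_def a_def b_def field_simps)
qed

text \<open>
  Equality makes all the estimates tight.  The number of connected sets then gives a path; its
  interior vertices are connected sets of weight \<open>0\<close>; and the split at its first vertex is balanced.
  Reversing the path puts the smaller weight first.
\<close>
lemma weighted_equality:
  assumes V: "finite V" "conn V" "2 \<le> card V" and p: "sum w V = p"
    and le: "(\<Sum>S\<in>conn_sets V. 2 ^ sum w S) \<le> weighted_bound (card V) p"
  shows "\<exists>x. end_weighted_path x V w (p div 2) ((p + 1) div 2)"
proof -
  define R where "R = conn_sets V - splits V - {V}"
  note est = weighted_estimates[OF V(1,2) p, folded R_def]
  note sum = weighted_sum(1)[OF V(1,2), of w, folded R_def, unfolded p]
    weighted_sum(2)[OF V(1,2), folded R_def]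
  have le': "2 ^ p + (\<Sum>A\<in>splits V. 2 ^ sum w A + 2 ^ sum w (V - A)) / 2 + (\<Sum>S\<in>R. 2 ^ sum w S)
      \<le> 2 ^ p + (real (card V) - 1) * (balanced_sum p - 2) + real (card V * (card V + 1)) / 2 - 1"
    using le unfolding sum(1) weighted_bound_alt .
  have split_le: "(\<Sum>A\<in>splits V. 2 ^ sum w A + 2 ^ sum w (V - A)) \<le> card (splits V) * balanced_sum p"
    and rest_le: "(\<Sum>S\<in>R. (2::real) ^ sum w S) \<le> card R"
    and conn_le: "real (card (conn_sets V)) \<le> real (card V * (card V + 1)) / 2"
    using le' est sum(2) by linarith+
  have "real (2 * card (conn_sets V)) \<le> real (card V * (card V + 1))" using conn_le by simp
  then have "2 * card (conn_sets V) \<le> card V * (card V + 1)" by (simp only: of_nat_le_iff)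
  then obtain x where x: "path_on x V" using path_if_few_conn_sets V by blast
  have inner: "w (x i) = 0" if i: "0 < i" "Suc i < card V" for i
  proof -
    have "{x i} \<in> R" using path_splits(2)[OF x V(1,3) i] by (simp add: R_def)
    then have "(2::real) ^ sum w {x i} = 1"
      using rest_le V by (intro sum_mono_eqD[of "\<lambda>S. 2 ^ sum w S" R "\<lambda>_. 1"]) (auto simp: R_def)
    then show ?thesis using power_inject_exp[of "2::real" "w (x i)" 0] by simp
  qed
  let ?l = "card V - 1"
  have ends: "w (x 0) + w (x ?l) = p"
    using sum_end_weights[of x V w "w (x 0)" "w (x ?l)" 0 ?l] x inner V p path_on_image[OF x]
    by (simp add: end_weighted_path_def atLeast0AtMost lessThan_Suc_atMost[symmetric])
  have s0: "{x 0} \<in> splits V" by (rule path_splits(1)[OF x V(1,3)])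
  have "(2::real) ^ sum w {x 0} + 2 ^ sum w (V - {x 0}) = balanced_sum p"
    using split_le V s0 p
    by (intro sum_mono_eqD[of "\<lambda>A. 2 ^ sum w A + 2 ^ sum w (V - A)" "splits V" "\<lambda>_. balanced_sum p"]
        balanced_sum_le) (auto simp: sum_split_weights)
  moreover have "sum w {x 0} + sum w (V - {x 0}) = p" using sum_split_weights[OF V(1) s0] p by simp
  ultimately have "w (x 0) = p div 2 \<or> w (x ?l) = p div 2"
    using balanced_if_le[of "w (x 0)" "sum w (V - {x 0})" p] ends by auto
  then show ?thesis
  proof
    assume "w (x 0) = p div 2"
    then show ?thesis using x inner ends
      by (intro exI[of _ x]) (auto simp: end_weighted_path_def)
  next
    assume "w (x ?l) = p div 2"
    moreover have "w (x (?l - i)) = 0" if "0 < i" "Suc i < card V" for i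
      using that by (intro inner) auto
    ultimately show ?thesis using path_on_reverse[OF x] ends
      by (intro exI[of _ "\<lambda>i. x (?l - i)"]) (auto simp: end_weighted_path_def)
  qed
qed

section \<open>Removing pendant vertices\<close>

text \<open>
  A set \<open>L\<close> of pendant vertices, pairwise non-adjacent, where \<open>h\<close> gives the neighbours.  It need
  not contain all pendant vertices, so that for a labelled double broom the leaves can be read off
  from the labels.
\<close>
definition leaf_system :: "'a set \<Rightarrow> 'a set \<Rightarrow> ('a \<Rightarrow> 'a) \<Rightarrow> bool" where
  "leaf_system V L h \<longleftrightarrow> L \<subseteq> V \<and> (\<forall>l\<in>L. h l \<in> V - L \<and> (\<forall>y\<in>V. E l y \<longleftrightarrow> y = h l))"

lemma leaf_systemD:
  assumes "leaf_system V L h" "l \<in> L"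
  shows "l \<in> V" "h l \<in> V" "h l \<notin> L" "y \<in> V \<Longrightarrow> E l y \<longleftrightarrow> y = h l"
  using assms by (auto simp: leaf_system_def)

text \<open>
  A leaf in a connected set with another vertex brings its neighbour along.  So a cut of the
  stripped set extends to a cut of the whole set with every leaf on the side of its neighbour, and
  an edge across the extended cut cannot end in a leaf.
\<close>
lemma conn_strip_leaves:
  assumes L: "leaf_system V L h" and S: "S \<subseteq> V" "conn S" and nl: "\<not> (\<exists>l\<in>L. S = {l})"
  shows "conn (S - L)" and "l \<in> S \<inter> L \<Longrightarrow> h l \<in> S"
proof -
  \<comment> \<open>A leaf in \<open>S\<close> has some neighbour in \<open>S\<close>, and \<open>h l\<close> is the only candidate.\<close>
  have hS: "h l \<in> S" if l: "l \<in> S \<inter> L" for l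
  proof -
    have "S \<noteq> {l}" using nl l by auto
    then obtain u where "u \<in> S" "E l u" using conn_nbr[OF S(2), of l] l by auto
    then show ?thesis using leaf_systemD(4)[OF L, of l u] S l by auto
  qed
  then show "l \<in> S \<inter> L \<Longrightarrow> h l \<in> S" .
  show "conn (S - L)"
    unfolding conn_def
  proof (intro conjI allI impI)
    obtain s where "s \<in> S" using conn_nonempty[OF S(2)] by auto
    then have "s \<in> S - L \<or> h s \<in> S - L" using hS leaf_systemD(3)[OF L] by auto
    then show "S - L \<noteq> {}" by auto
  next
    fix A assume A: "A \<subseteq> S - L \<and> A \<noteq> {} \<and> A \<noteq> S - L"
    \<comment> \<open>Every leaf joins the side of its neighbour.\<close>
    define B where "B = A \<union> {l \<in> S \<inter> L. h l \<in> A}"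
    have "B \<subseteq> S" "B \<noteq> {}" "B \<noteq> S" using A by (auto simp: B_def)
    then obtain a b where ab: "a \<in> B" "b \<in> S" "b \<notin> B" "E a b" using conn_cut[OF S(2)] by metis
    have "a \<notin> L"
    proof
      assume "a \<in> L"
      then have "b = h a" "h a \<in> A"
        using ab S A leaf_systemD(4)[OF L, of a b] by (auto simp: B_def)
      then show False using ab by (simp add: B_def)
    qed
    then have aA: "a \<in> A" using ab by (auto simp: B_def)
    have "b \<notin> L"
    proof
      assume "b \<in> L"
      then have "a = h b" using leaf_systemD(4)[OF L, of b a] ab(4) sym aA A S by blast
      then show False using ab aA \<open>b \<in> L\<close> by (auto simp: B_def)
    qed
    then show "\<exists>x\<in>A. \<exists>y\<in>S - L - A. E x y" using ab aA by (auto simp: B_def)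
  qed
qed

lemma conn_add_leaves:
  assumes L: "leaf_system V L h" and S: "conn S" "S \<subseteq> V" and B: "finite B" "B \<subseteq> {l \<in> L. h l \<in> S}"
  shows "conn (S \<union> B)"
  using B
proof (induction B rule: finite_induct)
  case empty
  then show ?case using S by simp
next
  case (insert l B)
  then have "E l (h l)" using leaf_systemD(2,4)[OF L, of l] by auto
  then have "conn (Set.insert l (S \<union> B))"
    using insert by (intro conn_insert[where x = "h l"]) (auto intro: sym)
  then show ?case by simp
qed

text \<open>
  A connected set other than a single leaf is determined by its part outside \<open>L\<close>, which is
  connected, and by an arbitrary set of leaves attached to that part.
\<close>
lemma card_conn_sets_leaves:
  assumes L: "leaf_system V L h" and V: "finite V"
  defines "w \<equiv> \<lambda>x. card {l \<in> L. h l = x}"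
  shows "card (conn_sets V) = card L + (\<Sum>S\<in>conn_sets (V - L). 2 ^ sum w S)"
proof -
  let ?att = "\<lambda>S. {l \<in> L. h l \<in> S}"
  let ?I = "Sigma (conn_sets (V - L)) (\<lambda>S. Pow (?att S))"
  have LV: "L \<subseteq> V" using L by (simp add: leaf_system_def)
  have finL: "finite L" using LV V finite_subset by blast
  have eq: "conn_sets V = (\<lambda>l. {l}) ` L \<union> (\<lambda>(S, B). S \<union> B) ` ?I"
  proof (intro subset_antisym subsetI)
    fix S assume S: "S \<in> conn_sets V"
    show "S \<in> (\<lambda>l. {l}) ` L \<union> (\<lambda>(S, B). S \<union> B) ` ?I"
    proof (cases "\<exists>l\<in>L. S = {l}")
      case False
      then have "conn (S - L)" "S \<inter> L \<subseteq> ?att (S - L)"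
        using conn_strip_leaves[OF L _ _ False] S leaf_systemD(3)[OF L] by (auto simp: conn_sets_iff)
      then have "(S - L, S \<inter> L) \<in> ?I" using S by (auto simp: conn_sets_iff)
      then show ?thesis by (intro UnI2 image_eqI[of _ _ "(S - L, S \<inter> L)"]) auto
    qed auto
  next
    fix S assume "S \<in> (\<lambda>l. {l}) ` L \<union> (\<lambda>(S, B). S \<union> B) ` ?I"
    then show "S \<in> conn_sets V"
    proof
      assume "S \<in> (\<lambda>l. {l}) ` L"
      then show ?thesis using LV by (auto simp: conn_sets_iff)
    next
      assume "S \<in> (\<lambda>(S, B). S \<union> B) ` ?I"
      then obtain T B where TB: "S = T \<union> B" "conn T" "T \<subseteq> V - L" "B \<subseteq> ?att T"
        by (auto simp: conn_sets_iff)
      moreover have "B \<subseteq> L" "T \<subseteq> V" using TB(3,4) by auto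
      moreover from this have "finite B" using finL by (simp add: finite_subset)
      ultimately have "conn S" using conn_add_leaves[OF L, of T B] by simp
      then show ?thesis using TB LV by (auto simp: conn_sets_iff)
    qed
  qed
  have inj: "inj_on (\<lambda>(S, B). S \<union> B) ?I"
  proof (rule inj_onI, clarify)
    fix S B T C
    assume "S \<in> conn_sets (V - L)" "T \<in> conn_sets (V - L)" "B \<subseteq> ?att S" "C \<subseteq> ?att T" "S \<union> B = T \<union> C"
    moreover from this have "S = (S \<union> B) - L" "T = (T \<union> C) - L" "B = (S \<union> B) \<inter> L" "C = (T \<union> C) \<inter> L"
      by (auto simp: conn_sets_iff)
    ultimately show "S = T \<and> B = C" by metis
  qed
  have ne: "{l} \<noteq> S \<union> B" if "l \<in> L" "S \<in> conn_sets (V - L)" for l S B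
  proof -
    have "conn S" "S \<inter> L = {}" using that(2) by (auto simp: conn_sets_iff)
    then obtain s where "s \<in> S" "s \<notin> L" using conn_nonempty[of S] by blast
    then have "s \<in> S \<union> B" "s \<notin> {l}" using that(1) by auto
    then show ?thesis by metis
  qed
  have disj: "(\<lambda>l. {l}) ` L \<inter> (\<lambda>(S, B). S \<union> B) ` ?I = {}"
  proof (rule equals0I)
    fix S assume "S \<in> (\<lambda>l. {l}) ` L \<inter> (\<lambda>(S, B). S \<union> B) ` ?I"
    then obtain l T B where "l \<in> L" "S = {l}" "T \<in> conn_sets (V - L)" "S = T \<union> B" by auto
    then show False using ne[of l T B] by simp
  qed
  have finI: "finite ?I" using V finL by auto
  have "card (?att S) = sum w S" if "S \<in> conn_sets (V - L)" for S
  proof -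
    have "S \<subseteq> V" using that by (auto simp: conn_sets_iff)
    then have "finite S" using V by (rule finite_subset)
    have "?att S = (\<Union>s\<in>S. {l \<in> L. h l = s})" by auto
    also have "card \<dots> = sum w S" unfolding w_def
      using \<open>finite S\<close> finL by (intro card_UN_disjoint) auto
    finally show ?thesis .
  qed
  then have cardI: "card ?I = (\<Sum>S\<in>conn_sets (V - L). 2 ^ sum w S)"
    using V finL by (simp add: card_Pow)
  have "card (conn_sets V) = card ((\<lambda>l. {l}) ` L) + card ((\<lambda>(S, B). S \<union> B) ` ?I)"
    unfolding eq using disj finI finL by (intro card_Un_disjoint) auto
  then show ?thesis using inj cardI by (simp add: card_image)
qed

lemma sum_leaf_weights:
  assumes L: "leaf_system V L h" and V: "finite V"
  shows "(\<Sum>x\<in>V - L. card {l \<in> L. h l = x}) = card L"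
proof -
  have "L \<subseteq> V" using L by (simp add: leaf_system_def)
  then have finL: "finite L" using V by (rule finite_subset)
  have "L = (\<Union>x\<in>V - L. {l \<in> L. h l = x})" using leaf_systemD(2,3)[OF L] by auto
  also have "card \<dots> = (\<Sum>x\<in>V - L. card {l \<in> L. h l = x})"
    using V finL by (intro card_UN_disjoint) auto
  finally show ?thesis by simp
qed

definition pendants :: "'a set \<Rightarrow> 'a set" where
  "pendants V = {v \<in> V. \<exists>!y. y \<in> V \<and> E v y}"

text \<open>
  Two adjacent pendant vertices would form a component of their own, of order \<open>2\<close>.
\<close>
lemma pendants_leaf_system:
  assumes V: "finite V" "conn V" "3 \<le> card V"
  obtains h where "leaf_system V (pendants V) h"
proof -
  define h where "h v = (THE y. y \<in> V \<and> E v y)" for v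
  have h: "h v \<in> V \<and> E v (h v)" "y \<in> V \<Longrightarrow> E v y \<Longrightarrow> y = h v" if "v \<in> pendants V" for v y
  proof -
    have ex1: "\<exists>!y. y \<in> V \<and> E v y" using that by (simp add: pendants_def)
    then show 1: "h v \<in> V \<and> E v (h v)" unfolding h_def by (rule theI')
    show "y \<in> V \<Longrightarrow> E v y \<Longrightarrow> y = h v" using ex1 1 by blast
  qed
  have "h v \<notin> pendants V" if v: "v \<in> pendants V" for v
  proof
    assume hv: "h v \<in> pendants V"
    have vV: "v \<in> V" using v by (simp add: pendants_def)
    have "E (h v) v" using h(1)[OF v] sym by blast
    then have hh: "v = h (h v)" by (rule h(2)[OF hv vV])
    have "card {v, h v} \<le> 2" using card_insert_le_m1[of 2 "{h v}" v] by simp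
    then have "{v, h v} \<noteq> V" using V(3) by auto
    moreover have "{v, h v} \<subseteq> V" using vV h(1)[OF v] by simp
    ultimately obtain a b where ab: "a \<in> {v, h v}" "b \<in> V" "b \<notin> {v, h v}" "E a b"
      using conn_cut[OF V(2), of "{v, h v}"] by (metis insert_not_empty)
    then have "b = h v \<or> b = h (h v)" using h(2)[OF v, of b] h(2)[OF hv, of b] by blast
    then show False using ab(3) unfolding hh[symmetric] by simp
  qed
  moreover have "E v y \<longleftrightarrow> y = h v" if "v \<in> pendants V" "y \<in> V" for v y
    using h(1)[OF that(1)] h(2)[OF that] by blast
  moreover have "pendants V \<subseteq> V" by (auto simp: pendants_def)
  ultimately have "leaf_system V (pendants V) h"
    using h(1) by (simp add: leaf_system_def)
  then show ?thesis using that by blast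
qed

lemma two_nbrs_if_not_pendant:
  assumes "conn V" "v \<in> V" "V \<noteq> {v}" "v \<notin> pendants V"
  obtains a b where "a \<in> V" "b \<in> V" "a \<noteq> b" "E v a" "E v b"
proof -
  obtain a where "a \<in> V" "E v a" using conn_nbr[OF assms(1-3)] by metis
  then show ?thesis using assms that unfolding pendants_def by blast
qed

section \<open>Non-cut vertices that are not pendant\<close>

text \<open>
  The connected sets that avoid \<open>v\<close> are at least \<open>n (n - 1) / 2\<close> in number by \<open>card_conn_sets_ge\<close>, those
  through \<open>v\<close> at least \<open>2 n - 2\<close> by \<open>rooted_ge2\<close>; the sum of both is half of \<open>n (n + 3) - 4\<close>.
\<close>
lemma noncut_degree_two_bound:
  assumes V: "finite V" "conn V" and v: "v \<in> V" "conn (V - {v})"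
    and ab: "a \<in> V" "b \<in> V" "a \<noteq> b" "E v a" "E v b"
  shows "card V * (card V + 3) \<le> 2 * card (conn_sets V) + 4"
    and "2 * card (conn_sets V) + 4 \<le> card V * (card V + 3) \<Longrightarrow>
      (\<exists>x. path_on x (V - {v})) \<and> card (rooted V v) \<le> 2 * card V - 2"
proof -
  have "v \<noteq> a" "v \<noteq> b" using ab irrefl by auto
  obtain n where n: "card (V - {v}) = n" "card V = Suc n" using V v by (metis card.remove)
  have eq: "card (conn_sets V) = card (conn_sets (V - {v})) + card (rooted V v)"
    using card_conn_sets_insert[of "V - {v}" v] V v by (simp add: insert_absorb)
  have 1: "n * (n + 1) \<le> 2 * card (conn_sets (V - {v}))"
    using card_conn_sets_ge[of "V - {v}"] V v n by simp
  have 2: "2 * n \<le> card (rooted V v)"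
    using rooted_ge2[OF V v(1) ab] n by simp
  show "card V * (card V + 3) \<le> 2 * card (conn_sets V) + 4"
    using 1 2 eq n by (simp add: algebra_simps)
  assume "2 * card (conn_sets V) + 4 \<le> card V * (card V + 3)"
  then have "2 * card (conn_sets (V - {v})) \<le> n * (n + 1)" "card (rooted V v) \<le> 2 * n"
    using 1 2 eq n by (simp_all add: algebra_simps)
  then show "(\<exists>x. path_on x (V - {v})) \<and> card (rooted V v) \<le> 2 * card V - 2"
    using path_if_few_conn_sets[of "V - {v}"] V v n by simp
qed

text \<open>
  There are two non-cut vertices, and at most one of them is pendant.
\<close>
lemma ex_noncut_nonpendant:
  assumes V: "finite V" "conn V" "2 \<le> card V" and p: "card (pendants V) \<le> 1"
  obtains v where "v \<in> V" "conn (V - {v})" "v \<notin> pendants V"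
proof -
  obtain z where "z \<in> V" using conn_nonempty[OF V(2)] by auto
  then obtain u where u: "u \<in> V" "conn (V - {u})"
    using ex_noncut_vertex[OF V(1,2)] V(3) by metis
  then obtain v where v: "v \<in> V" "v \<noteq> u" "conn (V - {v})"
    using ex_noncut_vertex[OF V(1,2)] V(3) by metis
  have "finite (pendants V)" using V by (simp add: pendants_def)
  then have "\<not> {u, v} \<subseteq> pendants V" using card_mono[of "pendants V" "{u, v}"] p v by auto
  then show ?thesis using that u v by auto
qed

text \<open>
  The path \<open>x\<close> runs through all vertices but \<open>v\<close> and starts with the edge of the triangle
  opposite to \<open>v\<close>.
\<close>
definition triangle_on :: "(nat \<Rightarrow> 'a) \<Rightarrow> 'a \<Rightarrow> 'a set \<Rightarrow> bool" where
  "triangle_on x v V \<longleftrightarrow> v \<in> V \<and> path_on x (V - {v}) \<and> (\<forall>i<card (V - {v}). E v (x i) \<longleftrightarrow> i \<le> 1)"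

text \<open>
  Any way through \<open>v\<close> can be short-cut by the edge between two neighbours of \<open>v\<close>.
\<close>
lemma conn_remove_simplicial:
  assumes S: "conn S" "S \<noteq> {v}"
    and nbrs: "\<And>a b. \<lbrakk>a \<in> S; b \<in> S; E v a; E v b; a \<noteq> b\<rbrakk> \<Longrightarrow> E a b"
  shows "conn (S - {v})"
  unfolding conn_def
proof (intro conjI allI impI)
  show "S - {v} \<noteq> {}" using S conn_nonempty by auto
next
  fix A assume A: "A \<subseteq> S - {v} \<and> A \<noteq> {} \<and> A \<noteq> S - {v}"
  then have sub: "A \<subseteq> S" "A \<noteq> {}" "A \<noteq> S" by auto
  obtain a b where ab: "a \<in> A" "b \<in> S" "b \<notin> A" "E a b"
    using conn_cut[OF S(1), of A] sub by metis
  show "\<exists>x\<in>A. \<exists>y\<in>S - {v} - A. E x y"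
  proof (cases "b = v")
    case False
    then show ?thesis using ab by auto
  next
    case True
    have "insert v A \<subseteq> S" "insert v A \<noteq> S" using A ab True by auto
    then obtain c d where cd: "c \<in> insert v A" "d \<in> S" "d \<notin> insert v A" "E c d"
      using conn_cut[OF S(1), of "insert v A"] by blast
    show ?thesis
    proof (cases "c = v")
      case True
      have "E a d" using nbrs[of a d] ab cd A sym True \<open>b = v\<close> by auto
      then show ?thesis using ab cd by auto
    next
      case False
      then show ?thesis using cd by auto
    qed
  qed
qed

text \<open>
  As the neighbours of \<open>v\<close> are adjacent, a connected set through \<open>v\<close> consists of \<open>v\<close> and possibly an
  interval of the path that starts with its first or second vertex: at most \<open>2 (n - 1)\<close> sets.
\<close>
lemma triangle_conn_sets_le:
  assumes V: "finite V" and x: "triangle_on x v V" and n: "2 \<le> card V"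
  shows "2 * card (conn_sets V) + 4 \<le> card V * (card V + 3)"
proof -
  define m where "m = card (V - {v})"
  have v: "v \<in> V" and P: "path_on x (V - {v})" and adj: "\<And>i. i < m \<Longrightarrow> E v (x i) \<longleftrightarrow> i \<le> 1"
    using x by (auto simp: triangle_on_def m_def)
  have cV: "card V = Suc m" unfolding m_def by (rule card.remove[OF V v])
  have eq: "card (conn_sets V) = card (conn_sets (V - {v})) + card (rooted V v)"
    using card_conn_sets_insert[of "V - {v}" v] V v by (simp add: insert_absorb)
  let ?F = "\<lambda>i j. insert v (x ` {i..j})"
  have "rooted V v \<subseteq> insert {v} (?F 0 ` {0..<m} \<union> ?F 1 ` {1..<m})"
  proof
    fix S assume "S \<in> rooted V v"
    then have S: "S \<subseteq> V" "conn S" "v \<in> S" by (auto simp: rooted_iff)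
    show "S \<in> insert {v} (?F 0 ` {0..<m} \<union> ?F 1 ` {1..<m})"
    proof (cases "S = {v}")
      case False
      have ix: "\<exists>i<m. a = x i" if "a \<in> S" "E v a" for a
        using that S irrefl path_on_image[OF P] unfolding m_def by blast
      have "conn (S - {v})"
      proof (rule conn_remove_simplicial[OF S(2) False])
        fix a b assume "a \<in> S" "b \<in> S" "E v a" "E v b" "a \<noteq> b"
        then obtain i j where "a = x i" "b = x j" "i < m" "j < m" "i \<le> 1" "j \<le> 1" "i \<noteq> j"
          using ix[of a] ix[of b] adj by auto
        then show "E a b" using path_on_adj[OF P, of i j] by (auto simp: m_def)
      qed
      then obtain i j where ij: "i \<le> j" "j < m" "S - {v} = x ` {i..j}"
        using conn_is_interval[OF P] S(1) unfolding m_def by (metis Diff_mono order_refl)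
      obtain u where u: "u \<in> S" "u \<noteq> v" "E v u" using conn_nbr[OF S(2,3) False] by metis
      then have "u \<in> x ` {i..j}" using ij(3) by blast
      then obtain k where k: "k \<in> {i..j}" "u = x k" by blast
      then have "k \<le> 1" using adj[of k] ij u by auto
      then have "i = 0 \<or> i = 1" using k by auto
      moreover have "S = ?F i j" using ij(3) S(3) by blast
      ultimately show ?thesis using ij by auto
    qed simp
  qed
  then have "card (rooted V v) \<le> card (insert {v} (?F 0 ` {0..<m} \<union> ?F 1 ` {1..<m}))"
    by (rule card_mono[rotated]) simp
  also have "\<dots> \<le> Suc (card (?F 0 ` {0..<m} \<union> ?F 1 ` {1..<m}))" by (rule card_insert_le_m1) auto
  also have "card (?F 0 ` {0..<m} \<union> ?F 1 ` {1..<m}) \<le> card (?F 0 ` {0..<m}) + card (?F 1 ` {1..<m})"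
    by (rule card_Un_le)
  also have "card (?F 0 ` {0..<m}) \<le> m" using card_image_le[of "{0..<m}" "?F 0"] by simp
  also have "card (?F 1 ` {1..<m}) \<le> m - 1" using card_image_le[of "{1..<m}" "?F 1"] by simp
  finally have "card (rooted V v) \<le> 2 * m" using n cV by simp
  moreover have "2 * card (conn_sets (V - {v})) = m * (m + 1)"
    using card_conn_sets_path[OF P] by (simp add: m_def)
  ultimately show ?thesis unfolding eq cV by (simp add: algebra_simps)
qed

text \<open>
  Take for \<open>v\<close> a non-cut vertex of degree at least \<open>2\<close>.  Equality in both parts of the count makes
  the rest a path and leaves exactly two connected sets of each size through \<open>v\<close>.  One end of the path
  is adjacent to \<open>v\<close>, as otherwise both ends would be pendant; after reversing, this is the first
  vertex.  A neighbour beyond the second vertex would give three connected sets of size \<open>3\<close>.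
\<close>
lemma triangle_if_few_conn_sets:
  assumes V: "finite V" "conn V" "4 \<le> card V" and p: "card (pendants V) \<le> 1"
    and few: "2 * card (conn_sets V) + 4 \<le> card V * (card V + 3)"
  shows "\<exists>x v. triangle_on x v V"
proof -
  obtain v where v: "v \<in> V" "conn (V - {v})" "v \<notin> pendants V"
    using ex_noncut_nonpendant[OF V(1,2) _ p] V(3) by auto
  have "V \<noteq> {v}" using V(3) by auto
  then obtain a b where ab: "a \<in> V" "b \<in> V" "a \<noteq> b" "E v a" "E v b"
    using two_nbrs_if_not_pendant[OF V(2) v(1) _ v(3)] by metis
  define m where "m = card (V - {v})"
  have cV: "card V = Suc m" unfolding m_def by (rule card.remove[OF V(1) v(1)])
  obtain x0 where x0: "path_on x0 (V - {v})" and r: "card (rooted V v) \<le> 2 * card V - 2"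
    using noncut_degree_two_bound(2)[OF V(1,2) v(1,2) ab few] by auto
  have "\<exists>x. path_on x (V - {v}) \<and> E v (x 0)"
  proof (rule ccontr)
    assume no: "\<not> ?thesis"
    have end_pendant: "x 0 \<in> pendants V" if x: "path_on x (V - {v})" for x
    proof -
      have "y = x 1" if "y \<in> V" "E (x 0) y" for y
      proof -
        have "y \<noteq> v" using that(2) no x sym by blast
        then have "y \<in> V - {v}" using that(1) by simp
        then obtain j where j: "j < m" "y = x j"
          using path_on_image[OF x] unfolding m_def by blast
        then have "j = 1" using path_on_adj[OF x, of 0 j] that(2) by (simp add: m_def)
        then show ?thesis using j by simp
      qed
      moreover have "E (x 0) (x 1)" using path_on_adj[OF x, of 0 1] cV V(3) by (simp add: m_def)
      moreover have "x 0 \<in> V" "x 1 \<in> V"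
        using path_on_mem[OF x, of 0] path_on_mem[OF x, of 1] cV V(3) by (auto simp: m_def)
      ultimately show ?thesis unfolding pendants_def by blast
    qed
    have "{x0 0, x0 (m - 1)} \<subseteq> pendants V"
      using end_pendant[OF x0] end_pendant[OF path_on_reverse[OF x0]] by (simp add: m_def)
    moreover have "x0 0 \<noteq> x0 (m - 1)"
      using path_on_inj[OF x0, of 0 "m - 1"] cV V(3) by (auto simp: m_def)
    moreover have "finite (pendants V)" using V by (simp add: pendants_def)
    ultimately show False using card_mono[of "pendants V" "{x0 0, x0 (m - 1)}"] p by auto
  qed
  then obtain x where x: "path_on x (V - {v})" and E0: "E v (x 0)" by auto
  have level: "card {S \<in> rooted V v. card S = k} = 2" if "2 \<le> k" "k < card V" for k
    using rooted_level_eq2[OF V(1,2) v(1) ab r that] .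
  have fin: "finite {S \<in> rooted V v. card S = k}" for k using V by simp
  have mem: "x i \<in> V" "x i \<noteq> v" if "i < m" for i
    using path_on_mem[OF x, of i] that by (auto simp: m_def)
  have inj: "x i = x j \<longleftrightarrow> i = j" if "i < m" "j < m" for i j
    using path_on_inj[OF x] that by (simp add: m_def)
  have m3: "3 \<le> m" using cV V(3) by simp
  have le1: "i \<le> 1" if i: "i < m" "E v (x i)" for i
  proof (rule ccontr)
    assume "\<not> i \<le> 1"
    then have i2: "2 \<le> i" by simp
    let ?S = "{v, x 0, x i}" and ?T = "{v, x 0, x 1}" and ?U = "{v, x i, x (i - 1)}"
    have E: "E (x 0) (x 1)" "E (x i) (x (i - 1))"
      using path_on_adj[OF x, of 0 1] path_on_adj[OF x, of i "i - 1"] i i2 by (auto simp: m_def)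
    have ne: "x 0 \<noteq> x 1" "x 0 \<noteq> x i" "x 1 \<noteq> x i" "x (i - 1) \<noteq> x i" "x 0 \<noteq> x (i - 1)"
      using inj i i2 by auto
    have "conn ?S" "conn ?T" "conn ?U"
      using conn_insert[OF conn_edge[OF E0], of v "x i"] conn_insert[OF conn_edge[OF E0], of "x 0" "x 1"]
        conn_insert[OF conn_edge[OF i(2)], of "x i" "x (i - 1)"] E i
      by (auto simp: insert_commute)
    moreover have "v \<noteq> x 0" "v \<noteq> x 1" "v \<noteq> x i" "v \<noteq> x (i - 1)"
      using mem(2)[of 0] mem(2)[of 1] mem(2)[of i] mem(2)[OF less_imp_diff_less[OF i(1)], of 1] i m3
      by auto
    then have "card ?S = 3" "card ?T = 3" "card ?U = 3" using ne by auto
    moreover have "x 0 \<notin> ?U" "x i \<notin> ?T" using ne mem[of 0] mem[of i] i m3 by auto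
    then have "?S \<noteq> ?T" "?S \<noteq> ?U" "?T \<noteq> ?U" by auto
    ultimately have "3 \<le> card {S \<in> rooted V v. card S = 3}"
      using mem v i i2 m3 by (intro card_ge_3I[of ?S ?T ?U] fin) (auto simp: rooted_iff)
    then show False using level[of 3] cV m3 by simp
  qed
  have "\<exists>i<m. i \<noteq> 0 \<and> E v (x i)"
  proof -
    have "a \<in> V - {v}" "b \<in> V - {v}" using ab irrefl by auto
    then have "a \<in> x ` {..<m}" "b \<in> x ` {..<m}" unfolding m_def path_on_image[OF x] by simp_all
    then obtain i j where "i < m" "j < m" "a = x i" "b = x j" by auto
    then show ?thesis using ab(3-5) by metis
  qed
  then have "E v (x 1)" using le1 by (metis One_nat_def le_SucE le_zero_eq)
  then have "E v (x i) \<longleftrightarrow> i \<le> 1" if "i < m" for i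
    using le1[OF that] E0 by (auto simp: le_Suc_eq)
  then show ?thesis using x v unfolding triangle_on_def m_def by blast
qed

end

section \<open>Labelled double brooms and triangles with a path\<close>

text \<open>
  The adjacency of the double broom with handle \<open>{..<m}\<close>, where the first \<open>q\<close> labels from \<open>m\<close> on are
  the leaves at \<open>0\<close> and all later ones are the leaves at \<open>m - 1\<close>.
\<close>
definition broom_adj :: "nat \<Rightarrow> nat \<Rightarrow> nat \<Rightarrow> nat \<Rightarrow> bool" where
  "broom_adj m q i j \<longleftrightarrow>
     (i < m \<and> j < m \<and> (j = Suc i \<or> i = Suc j)) \<or>
     (i = 0 \<and> m \<le> j \<and> j < m + q) \<or> (j = 0 \<and> m \<le> i \<and> i < m + q) \<or>
     (i = m - 1 \<and> m + q \<le> j) \<or> (j = m - 1 \<and> m + q \<le> i)"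

definition triangle_path_adj :: "nat \<Rightarrow> nat \<Rightarrow> nat \<Rightarrow> bool" where
  "triangle_path_adj n i j \<longleftrightarrow>
     (i < n - 2 \<and> j < n - 2 \<and> (j = Suc i \<or> i = Suc j)) \<or>
     (i \<in> {0, n - 2, n - 1} \<and> j \<in> {0, n - 2, n - 1} \<and> i \<noteq> j)"

definition broom_bound :: "nat \<Rightarrow> nat \<Rightarrow> real" where
  "broom_bound n p = real p + weighted_bound (n - p) p"

context simple_adjacency
begin

text \<open>
  The set of vertices reachable from \<open>u\<close> has no outgoing edge; conversely, a walk from one side of a
  cut to the other uses an edge across it.
\<close>
lemma conn_iff_reachable:
  "conn S \<longleftrightarrow> S \<noteq> {} \<and> (\<forall>u\<in>S. \<forall>v\<in>S. (u, v) \<in> rtrancl_on S {(x, y). x \<in> S \<and> y \<in> S \<and> E x y})"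
  (is "_ \<longleftrightarrow> _ \<and> (\<forall>u\<in>S. \<forall>v\<in>S. (u, v) \<in> ?R)")
proof (intro iffI conjI ballI)
  fix u v assume S: "conn S" and u: "u \<in> S" and v: "v \<in> S"
  let ?A = "{y \<in> S. (u, y) \<in> ?R}"
  have "?A = S"
  proof (rule ccontr)
    assume "?A \<noteq> S"
    moreover have "u \<in> ?A" using u by simp
    ultimately obtain x y where "x \<in> ?A" "y \<in> S" "y \<notin> ?A" "E x y"
      using conn_cut[OF S, of ?A] by blast
    moreover from this have "(u, y) \<in> ?R" by (auto intro: rtrancl_on_into_rtrancl_on)
    ultimately show False by simp
  qed
  then show "(u, v) \<in> ?R" using v by blast
next
  assume *: "S \<noteq> {} \<and> (\<forall>u\<in>S. \<forall>v\<in>S. (u, v) \<in> ?R)"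
  show "conn S"
    unfolding conn_def
  proof (intro conjI allI impI)
    show "S \<noteq> {}" using * by simp
    fix A assume A: "A \<subseteq> S \<and> A \<noteq> {} \<and> A \<noteq> S"
    then obtain a b where ab: "a \<in> A" "b \<in> S" "b \<notin> A" by blast
    show "\<exists>x\<in>A. \<exists>y\<in>S - A. E x y"
    proof (rule ccontr)
      assume no: "\<not> ?thesis"
      have "(a, b) \<in> ?R" using * A ab by blast
      then have "b \<in> A"
      proof (induction rule: rtrancl_on_induct)
        case base
        show ?case by (rule ab)
      next
        case (step y z)
        then show ?case using no by blast
      qed
      then show False using ab by simp
    qed
  qed
qed (use conn_nonempty in blast)

lemma path_on_initial_segment:
  assumes g: "inj_on g {..<m}" and adj: "\<And>i j. \<lbrakk>i < m; j < m\<rbrakk> \<Longrightarrow> E (g i) (g j) \<longleftrightarrow> j = Suc i \<or> i = Suc j"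
  shows "path_on g (g ` {..<m})" "card (g ` {..<m}) = m"
  using assms by (auto simp: path_on_def card_image bij_betw_def)

definition broom_labelling :: "(nat \<Rightarrow> 'a) \<Rightarrow> nat \<Rightarrow> nat \<Rightarrow> 'a set \<Rightarrow> bool" where
  "broom_labelling g n p V \<longleftrightarrow> bij_betw g {..<n} V \<and>
     (\<forall>i<n. \<forall>j<n. E (g i) (g j) \<longleftrightarrow> broom_adj (n - p) (p div 2) i j)"

lemma card_without_leaves:
  assumes "leaf_system V L h" "finite V"
  shows "card (V - L) = card V - card L"
proof -
  have "L \<subseteq> V" using assms(1) by (simp add: leaf_system_def)
  then show ?thesis using assms(2) by (simp add: card_Diff_subset finite_subset)
qed

lemma conn_without_leaves:
  assumes "leaf_system V L h" "conn V" "2 \<le> card V"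
  shows "conn (V - L)"
proof -
  have "V \<noteq> {l}" for l using assms(3) by auto
  then show ?thesis using conn_strip_leaves(1)[OF assms(1) subset_refl assms(2)] by blast
qed

lemma real_card_conn_sets_leaves:
  assumes "leaf_system V L h" "finite V"
  shows "real (card (conn_sets V))
    = card L + (\<Sum>S\<in>conn_sets (V - L). 2 ^ (\<Sum>x\<in>S. card {l \<in> L. h l = x}))"
  using card_conn_sets_leaves[OF assms] by simp

lemma broom_bound_le:
  assumes V: "finite V" "conn V" "3 \<le> card V" "card (pendants V) = p"
  shows "broom_bound (card V) p \<le> card (conn_sets V)"
proof -
  obtain h where h: "leaf_system V (pendants V) h" by (rule pendants_leaf_system[OF V(1-3)])
  have I: "conn (V - pendants V)" using conn_without_leaves[OF h V(2)] V(3) by simp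
  have "card (V - pendants V) = card V - p"
    using card_without_leaves[OF h V(1)] V(4) by simp
  then show ?thesis
    using weighted_bound_le[OF _ I sum_leaf_weights[OF h V(1)]] V
    by (simp add: real_card_conn_sets_leaves[OF h V(1)] broom_bound_def)
qed

text \<open>
  By \<open>weighted_equality\<close> the non-pendant vertices form a path with all pendant vertices at its ends.
  The labelling continues the path by the leaves at the first end, then by those at the last end.
\<close>
lemma broom_equality:
  assumes V: "finite V" "conn V" "3 \<le> card V" "card (pendants V) = p" "p + 2 \<le> card V"
    and le: "card (conn_sets V) \<le> broom_bound (card V) p"
  shows "\<exists>g. broom_labelling g (card V) p V"
proof -
  let ?L = "pendants V" and ?n = "card V" and ?q = "p div 2"
  obtain h where h: "leaf_system V ?L h" by (rule pendants_leaf_system[OF V(1-3)])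
  define w where "w x = card {l \<in> ?L. h l = x}" for x
  define m where "m = ?n - p"
  have LV: "?L \<subseteq> V" and finL: "finite ?L" using V h by (auto simp: leaf_system_def finite_subset)
  have I: "conn (V - ?L)" using conn_without_leaves[OF h V(2)] V(3) by simp
  have cI: "card (V - ?L) = m"
    using card_without_leaves[OF h V(1)] V(4) by (simp add: m_def)
  have m2: "2 \<le> m" "m \<le> ?n" using V(5) by (auto simp: m_def)
  have "(\<Sum>S\<in>conn_sets (V - ?L). (2::real) ^ sum w S) \<le> weighted_bound (card (V - ?L)) p"
    using le V(4) by (simp add: real_card_conn_sets_leaves[OF h V(1)] broom_bound_def cI m_def w_def)
  then obtain x where "end_weighted_path x (V - ?L) w (p div 2) ((p + 1) div 2)"
    using weighted_equality[of "V - ?L" w p] V(1,4) I m2(1) sum_leaf_weights[OF h V(1)]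
    by (auto simp: cI w_def)
  then have x: "path_on x (V - ?L)" and w0: "w (x 0) = ?q" and w1: "w (x (m - 1)) = (p + 1) div 2"
    and w: "\<And>i. \<lbrakk>0 < i; Suc i < m\<rbrakk> \<Longrightarrow> w (x i) = 0"
    by (auto simp: end_weighted_path_def cI)
  have n: "?n = m + p" using V(5) by (simp add: m_def)
  let ?A = "{l \<in> ?L. h l = x 0}" and ?B = "{l \<in> ?L. h l = x (m - 1)}"
  \<comment> \<open>A vertex with a leaf has positive weight and so is an end of the path.\<close>
  have h_ends: "h l = x 0 \<or> h l = x (m - 1)" if "l \<in> ?L" for l
  proof -
    have "h l \<in> V - ?L" using leaf_systemD[OF h that] by simp
    then obtain i where i: "i < m" "h l = x i" using path_on_image[OF x] cI by auto
    have "0 < w (h l)" unfolding w_def using that finL by (auto simp: card_gt_0_iff)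
    then have "\<not> (0 < i \<and> Suc i < m)" using w[of i] i by auto
    then show ?thesis using i by (metis One_nat_def Suc_lessI diff_Suc_1 neq0_conv)
  qed
  have ends: "x 0 \<noteq> x (m - 1)" using path_on_inj[OF x, of 0 "m - 1"] cI m2 by auto
  obtain f where f: "bij_betw f {m..<m + ?q} ?A"
    using finite_same_card_bij[of "{m..<m + ?q}" ?A] w0 finL by (auto simp: w_def)
  have half: "p - ?q = (p + 1) div 2" by linarith
  obtain f' where f': "bij_betw f' {m + ?q..<?n} ?B"
    using finite_same_card_bij[of "{m + ?q..<?n}" ?B] w1 finL n half by (auto simp: w_def)
  define g where "g i = (if i < m then x i else if i < m + ?q then f i else f' i)" for i
  have g0: "bij_betw g {..<m} (V - ?L)"
    using path_on_bij[OF x, unfolded cI] by (rule iffD2[OF bij_betw_cong, rotated]) (simp add: g_def)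
  have g1: "bij_betw g {m..<m + ?q} ?A"
    using f by (rule iffD2[OF bij_betw_cong, rotated]) (simp add: g_def)
  have g2: "bij_betw g {m + ?q..<?n} ?B"
    using f' by (rule iffD2[OF bij_betw_cong, rotated]) (simp add: g_def)
  have "bij_betw g ({..<m} \<union> ({m..<m + ?q} \<union> {m + ?q..<?n})) ((V - ?L) \<union> (?A \<union> ?B))"
    using ends by (intro bij_betw_combine g0 g1 g2) auto
  moreover have "{..<m} \<union> ({m..<m + ?q} \<union> {m + ?q..<?n}) = {..<?n}" using n by auto
  moreover have "(V - ?L) \<union> (?A \<union> ?B) = V" using h_ends LV by blast
  ultimately have g: "bij_betw g {..<?n} V" by simp
  have gx: "g i = x i" if "i < m" for i using that by (simp add: g_def)
  have inV: "g i \<in> V" if "i < ?n" for i using g that by (auto simp: bij_betw_def)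
  have gA: "g i \<in> ?L" "h (g i) = g 0" if "m \<le> i" "i < m + ?q" for i
    using g1 that gx m2 by (auto simp: bij_betw_def)
  have gB: "g i \<in> ?L" "h (g i) = g (m - 1)" if "m + ?q \<le> i" "i < ?n" for i
    using g2 that gx m2 by (auto simp: bij_betw_def)
  have inj: "g i = g j \<longleftrightarrow> i = j" if "i < ?n" "j < ?n" for i j
    using g that by (auto simp: bij_betw_def inj_on_def)
  have leaf_adj: "E (g i) (g j) \<longleftrightarrow> j = (if i < m + ?q then 0 else m - 1)"
    if "m \<le> i" "i < ?n" "j < ?n" for i j
  proof (cases "i < m + ?q")
    case True
    then show ?thesis
      using leaf_systemD(4)[OF h gA(1)[OF that(1)] inV[OF that(3)]] gA(2)[OF that(1)]
        inj[of j 0] that m2 by simp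
  next
    case False
    then show ?thesis
      using leaf_systemD(4)[OF h gB(1)[of i] inV[OF that(3)]] gB(2)[of i]
        inj[of j "m - 1"] that m2 by simp
  qed
  have "E (g i) (g j) \<longleftrightarrow> broom_adj m ?q i j" if ij: "i < ?n" "j < ?n" for i j
  proof (cases "m \<le> i \<or> m \<le> j")
    case True
    then show ?thesis
    proof
      assume "m \<le> i"
      then show ?thesis using leaf_adj[of i j] ij m2 unfolding broom_adj_def by auto
    next
      assume "m \<le> j"
      moreover have "E (g i) (g j) \<longleftrightarrow> E (g j) (g i)" using sym by blast
      ultimately show ?thesis using leaf_adj[of j i] ij m2 unfolding broom_adj_def by auto
    qed
  next
    case False
    then show ?thesis using path_on_adj[OF x, of i j] cI gx[of i] gx[of j] m2
      unfolding broom_adj_def by auto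
  qed
  then show ?thesis using g unfolding broom_labelling_def m_def by blast
qed

text \<open>
  The labels from \<open>n - p\<close> on are leaves, and removing them leaves a path to which
  \<open>weighted_sum_path\<close> applies.
\<close>
lemma broom_conn_sets:
  assumes V: "finite V" and g: "broom_labelling g n p V" and p: "p + 2 \<le> n"
  shows "real (card (conn_sets V)) = broom_bound n p"
proof -
  let ?q = "p div 2"
  define m where "m = n - p"
  have n: "n = m + p" and m2: "2 \<le> m" using p by (auto simp: m_def)
  define L h where "L = g ` {m..<n}"
    and "h l = (if l \<in> g ` {m..<m + ?q} then g 0 else g (m - 1))" for l
  have bij: "bij_betw g {..<n} V" and adj: "\<And>i j. \<lbrakk>i < n; j < n\<rbrakk> \<Longrightarrow> E (g i) (g j) \<longleftrightarrow> broom_adj m ?q i j"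
    using g by (auto simp: broom_labelling_def m_def)
  have img: "V = g ` {..<n}" and inj: "inj_on g {..<n}" using bij by (auto simp: bij_betw_def)
  have injD: "g i = g j \<longleftrightarrow> i = j" if "i < n" "j < n" for i j
    using inj that by (auto simp: inj_on_def)
  have memD: "g i \<in> g ` A \<longleftrightarrow> i \<in> A" if "i < n" "A \<subseteq> {..<n}" for i A
    using inj_on_image_mem_iff[OF inj] that by auto
  have VL: "V - L = g ` {..<m}"
    unfolding img L_def using inj n
    by (subst inj_on_image_set_diff[symmetric, OF inj]) (auto intro!: arg_cong[of _ _ "\<lambda>A. g ` A"])
  have hg: "h (g i) = (if i < m + ?q then g 0 else g (m - 1))" if "m \<le> i" "i < n" for i
  proof -
    have "{m..<m + ?q} \<subseteq> {..<n}" using n m2 by auto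
    then show ?thesis using memD[OF that(2), of "{m..<m + ?q}"] that(1) by (simp add: h_def)
  qed
  have leaf: "leaf_system V L h"
    unfolding leaf_system_def
  proof (intro conjI ballI)
    show "L \<subseteq> V" by (auto simp: L_def img)
  next
    fix l assume "l \<in> L"
    then obtain i where i: "m \<le> i" "i < n" "l = g i" by (auto simp: L_def)
    show "h l \<in> V - L" using hg[OF i(1,2)] i n m2 unfolding VL by auto
    fix y assume "y \<in> V"
    then obtain j where "j < n" "y = g j" by (auto simp: img)
    then show "E l y \<longleftrightarrow> y = h l"
      using hg[OF i(1,2)] i adj[of i j] injD[of j 0] injD[of j "m - 1"] n m2
      unfolding broom_adj_def by auto
  qed
  define w where "w x = card {l \<in> L. h l = x}" for x
  have injm: "inj_on g {..<m}" using inj by (rule inj_on_subset) (use n in auto)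
  have "E (g i) (g j) \<longleftrightarrow> j = Suc i \<or> i = Suc j" if "i < m" "j < m" for i j
    using adj[of i j] that n by (auto simp: broom_adj_def)
  then have x: "path_on g (V - L)" and cI: "card (V - L) = m"
    unfolding VL using path_on_initial_segment[OF injm] by blast+
  have cardg: "card (g ` A) = card A" if "A \<subseteq> {..<n}" for A
    using inj that by (meson card_image inj_on_subset)
  have ends: "g 0 \<noteq> g (m - 1)" using injD[of 0 "m - 1"] n m2 by auto
  have sub: "{m..<m + ?q} \<subseteq> {..<n}" "{m + ?q..<n} \<subseteq> {..<n}" using n by auto
  have "{l \<in> L. h l = g 0} = g ` {m..<m + ?q}"
    using hg ends n m2 by (auto simp: L_def split: if_splits)
  then have w0: "w (g 0) = ?q" using cardg[OF sub(1)] by (simp add: w_def)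
  have "{l \<in> L. h l = g (m - 1)} = g ` {m + ?q..<n}"
    using hg ends n m2 by (auto simp: L_def split: if_splits)
  then have w1: "w (g (m - 1)) = (p + 1) div 2" using cardg[OF sub(2)] n by (simp add: w_def)
  have "w (g i) = 0" if "0 < i" "Suc i < m" for i
  proof -
    have "g i \<noteq> g 0" "g i \<noteq> g (m - 1)" using injD[of i 0] injD[of i "m - 1"] that n by auto
    then have "{l \<in> L. h l = g i} = {}" by (auto simp: h_def)
    then show ?thesis unfolding w_def by (simp only: card.empty)
  qed
  then have "end_weighted_path g (V - L) w ?q ((p + 1) div 2)"
    using x w0 w1 by (simp add: end_weighted_path_def cI)
  from weighted_sum_path[OF this] have "(\<Sum>S\<in>conn_sets (V - L). (2::real) ^ sum w S) = weighted_bound m p"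
    using n m2 by (simp add: cI)
  moreover have "{m..<n} \<subseteq> {..<n}" by auto
  then have "card L = p" unfolding L_def using cardg[of "{m..<n}"] n by simp
  ultimately show ?thesis
    using real_card_conn_sets_leaves[OF leaf V] by (simp add: broom_bound_def w_def m_def)
qed

text \<open>
  The two descriptions number the vertices differently: along the path of \<open>triangle_on\<close> the labels
  are \<open>n - 2, 0, 1, \<dots>, n - 3\<close>, and \<open>v\<close> has the label \<open>n - 1\<close>.
\<close>
lemma triangle_on_iff_labelling:
  assumes V: "finite V" "card V = n" and n: "4 \<le> n"
  shows "(\<exists>x v. triangle_on x v V) \<longleftrightarrow>
    (\<exists>g. bij_betw g {..<n} V \<and> (\<forall>i<n. \<forall>j<n. E (g i) (g j) \<longleftrightarrow> triangle_path_adj n i j))"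
proof
  assume "\<exists>x v. triangle_on x v V"
  then obtain x v where v: "v \<in> V" and x: "path_on x (V - {v})"
    and adj: "\<And>i. i < card (V - {v}) \<Longrightarrow> E v (x i) \<longleftrightarrow> i \<le> 1"
    by (auto simp: triangle_on_def)
  have c: "card (V - {v}) = n - 1" using v V by simp
  \<comment> \<open>\<open>s\<close> turns a label below \<open>n - 1\<close> into the position on the path.\<close>
  define s where "s i = (if i = n - 2 then 0 else Suc i)" for i
  define g where "g i = (if i = n - 1 then v else x (s i))" for i
  have "bij_betw s {..<n - 1} {..<n - 1}"
    by (rule bij_betw_byWitness[where f' = "\<lambda>k. if k = 0 then n - 2 else k - 1"])
      (use n in \<open>auto simp: s_def\<close>)
  from bij_betw_trans[OF this path_on_bij[OF x, unfolded c]]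
  have "bij_betw g {..<n - 1} (V - {v})"
    by (rule iffD2[OF bij_betw_cong, rotated]) (auto simp: g_def)
  moreover have "bij_betw g {n - 1} {v}" by (simp add: bij_betw_def g_def)
  ultimately have "bij_betw g ({..<n - 1} \<union> {n - 1}) ((V - {v}) \<union> {v})"
    by (rule bij_betw_combine) simp
  moreover have "{..<n - 1} \<union> {n - 1} = {..<n}" using n by auto
  moreover have "(V - {v}) \<union> {v} = V" using v by auto
  ultimately have "bij_betw g {..<n} V" by simp
  moreover have "E (g i) (g j) \<longleftrightarrow> triangle_path_adj n i j" if ij: "i < n" "j < n" for i j
  proof -
    have vs: "E v (x (s k)) \<longleftrightarrow> k = 0 \<or> k = n - 2" if "k < n - 1" for k
      using adj[of "s k"] that n by (auto simp: s_def c)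
    consider "i = n - 1" "j = n - 1" | "i = n - 1" "j < n - 1" | "i < n - 1" "j = n - 1"
      | "i < n - 1" "j < n - 1" using ij by linarith
    then show ?thesis
    proof cases
      case 1
      then show ?thesis using irrefl n by (auto simp: triangle_path_adj_def)
    next
      case 2
      then show ?thesis using vs[of j] n by (auto simp: triangle_path_adj_def g_def)
    next
      case 3
      then have "E (g i) (g j) \<longleftrightarrow> E v (x (s i))" using sym by (auto simp: g_def)
      then show ?thesis using 3 vs[of i] n by (auto simp: triangle_path_adj_def)
    next
      case 4
      then have "E (g i) (g j) \<longleftrightarrow> s j = Suc (s i) \<or> s i = Suc (s j)"
        using path_on_adj[OF x, of "s i" "s j"] n by (auto simp: g_def c s_def)
      then show ?thesis using 4 n by (auto simp: triangle_path_adj_def s_def)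
    qed
  qed
  ultimately show "\<exists>g. bij_betw g {..<n} V \<and> (\<forall>i<n. \<forall>j<n. E (g i) (g j) \<longleftrightarrow> triangle_path_adj n i j)"
    by blast
next
  assume "\<exists>g. bij_betw g {..<n} V \<and> (\<forall>i<n. \<forall>j<n. E (g i) (g j) \<longleftrightarrow> triangle_path_adj n i j)"
  then obtain g where g: "bij_betw g {..<n} V"
    and adj: "\<And>i j. \<lbrakk>i < n; j < n\<rbrakk> \<Longrightarrow> E (g i) (g j) \<longleftrightarrow> triangle_path_adj n i j" by blast
  define s where "s k = (if k = 0 then n - 2 else k - 1)" for k
  have v: "g (n - 1) \<in> V" using g n by (auto simp: bij_betw_def)
  then have c: "card (V - {g (n - 1)}) = n - 1" using V by simp
  have "{..<n - 1} = {..<n} - {n - 1}" using n by auto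
  then have "bij_betw g {..<n - 1} (V - {g (n - 1)})"
    using bij_betw_DiffI[OF g, of "{n - 1}" "{g (n - 1)}"] v n by (simp add: bij_betw_def)
  moreover have "bij_betw s {..<n - 1} {..<n - 1}"
    by (rule bij_betw_byWitness[where f' = "\<lambda>i. if i = n - 2 then 0 else Suc i"])
      (use n in \<open>auto simp: s_def\<close>)
  ultimately have "bij_betw (g \<circ> s) {..<n - 1} (V - {g (n - 1)})" by (rule bij_betw_trans[rotated])
  moreover have "E (g (s i)) (g (s j)) \<longleftrightarrow> j = Suc i \<or> i = Suc j" if "i < n - 1" "j < n - 1" for i j
  proof -
    have "s i < n" "s j < n" using that n by (auto simp: s_def)
    moreover have "triangle_path_adj n (s i) (s j) \<longleftrightarrow> j = Suc i \<or> i = Suc j"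
      using that n by (cases i; cases j) (auto simp: s_def triangle_path_adj_def)
    ultimately show ?thesis using adj by simp
  qed
  ultimately have "path_on (g \<circ> s) (V - {g (n - 1)})" unfolding path_on_def c by simp
  moreover have "E (g (n - 1)) (g (s i)) \<longleftrightarrow> i \<le> 1" if "i < n - 1" for i
  proof -
    have "s i < n" "n - 1 < n" using that n by (auto simp: s_def)
    moreover have "triangle_path_adj n (n - 1) (s i) \<longleftrightarrow> i \<le> 1"
      using that n by (cases i) (auto simp: s_def triangle_path_adj_def)
    ultimately show ?thesis using adj by simp
  qed
  ultimately have "triangle_on (g \<circ> s) (g (n - 1)) V"
    using v unfolding triangle_on_def c by simp
  then show "\<exists>x v. triangle_on x v V" by blast
qed

end

section \<open>Transfer to digraphs\<close>

lemma pair_graph_simple_adjacency: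
  assumes "pair_graph G"
  shows "simple_adjacency (\<lambda>x y. (x, y) \<in> parcs G)"
proof -
  interpret pair_graph G by fact
  show ?thesis by unfold_locales (auto intro: arcs_symmetric dest: no_loops')
qed

lemma connected_induced_iff:
  assumes "pair_graph G" "S \<subseteq> pverts G"
  shows "connected (with_proj G \<restriction> S) \<longleftrightarrow> simple_adjacency.conn (\<lambda>x y. (x, y) \<in> parcs G) S"
proof -
  interpret pair_graph G by fact
  interpret A: simple_adjacency "\<lambda>x y. (x, y) \<in> parcs G"
    by (rule pair_graph_simple_adjacency) fact
  have "parcs (mk_symmetric (with_proj G \<restriction> S)) = {(x, y). x \<in> S \<and> y \<in> S \<and> (x, y) \<in> parcs G}"
    by (auto simp: parcs_mk_symmetric induce_subgraph_def intro: arcs_symmetric)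
  then show ?thesis
    by (simp add: A.conn_iff_reachable connected_def strongly_connected_def reachable_def)
qed

lemma connected_iff_conn:
  assumes "pair_graph G"
  shows "connected (with_proj G) \<longleftrightarrow> simple_adjacency.conn (\<lambda>x y. (x, y) \<in> parcs G) (pverts G)"
proof -
  interpret pair_graph G by fact
  have "with_proj G \<restriction> pverts G = with_proj G"
    by (auto simp: induce_subgraph_def with_proj_def dest: in_arcsD1 in_arcsD2)
  then show ?thesis using connected_induced_iff[OF assms subset_refl] by simp
qed

lemma num_connected_induced_eq:
  assumes "pair_graph G"
  shows "num_connected_induced (with_proj G)
    = card (simple_adjacency.conn_sets (\<lambda>x y. (x, y) \<in> parcs G) (pverts G))"
proof -
  interpret A: simple_adjacency "\<lambda>x y. (x, y) \<in> parcs G"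
    by (rule pair_graph_simple_adjacency) fact
  have "{S. S \<subseteq> verts (with_proj G) \<and> S \<noteq> {} \<and> connected (with_proj G \<restriction> S)} = A.conn_sets (pverts G)"
    using connected_induced_iff[OF assms] A.conn_nonempty by (auto simp: A.conn_sets_iff)
  then show ?thesis by (simp add: num_connected_induced_def)
qed

lemma pendant_verts_eq:
  assumes "pair_graph G"
  shows "pendant_verts (with_proj G) = simple_adjacency.pendants (\<lambda>x y. (x, y) \<in> parcs G) (pverts G)"
proof -
  interpret pair_graph G by fact
  interpret A: simple_adjacency "\<lambda>x y. (x, y) \<in> parcs G"
    by (rule pair_graph_simple_adjacency) fact
  have "out_degree (with_proj G) v = 1 \<longleftrightarrow> (\<exists>!y. y \<in> pverts G \<and> (v, y) \<in> parcs G)" for v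
  proof -
    have "out_arcs (with_proj G) v = Pair v ` {y. y \<in> pverts G \<and> (v, y) \<in> parcs G}"
      using in_arcsD2 by (force simp: out_arcs_def)
    then have "out_degree (with_proj G) v = card {y. y \<in> pverts G \<and> (v, y) \<in> parcs G}"
      by (simp add: out_degree_def card_image inj_on_def)
    then show ?thesis unfolding One_nat_def by (simp add: card_1_singleton_iff set_eq_iff) metis
  qed
  then show ?thesis by (auto simp: pendant_verts_def A.pendants_def)
qed

text \<open>
  An isomorphism of digraphs also carries a map of arcs and new head and tail functions.  For arcs
  that are pairs of vertices, these are determined by the map of vertices.
\<close>
lemma digraph_iso_with_proj_iff:
  assumes G: "pair_wf_digraph G" and H: "pair_wf_digraph H"
  shows "digraph_iso (with_proj G) (with_proj H) \<longleftrightarrow>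
    (\<exists>g. bij_betw g (pverts H) (pverts G) \<and>
      (\<forall>i\<in>pverts H. \<forall>j\<in>pverts H. (g i, g j) \<in> parcs G \<longleftrightarrow> (i, j) \<in> parcs H))"
proof
  interpret G: pair_wf_digraph G by fact
  interpret H: pair_wf_digraph H by fact
  assume "digraph_iso (with_proj G) (with_proj H)"
  then obtain f where f: "pre_digraph.digraph_isomorphism (with_proj G) f"
    and Hf: "with_proj H = app_iso f (with_proj G)" by (auto simp: digraph_iso_def)
  let ?k = "iso_verts f"
  have inj: "inj_on ?k (pverts G)" using f by (simp add: G.digraph_isomorphism_def)
  have pH: "pverts H = ?k ` pverts G" using arg_cong[OF Hf, of verts] by (simp add: verts_app_iso)
  have aH: "parcs H = iso_arcs f ` parcs G" using arg_cong[OF Hf, of arcs] by (simp add: arcs_app_iso)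
  have th: "iso_tail f = fst" "iso_head f = snd"
    using arg_cong[OF Hf, of tail] arg_cong[OF Hf, of head] by (simp_all add: tail_app_iso head_app_iso)
  have "iso_arcs f (u, v) = (?k u, ?k v)" if "(u, v) \<in> parcs G" for u v
    using f that unfolding G.digraph_isomorphism_def th by (auto simp: prod_eq_iff)
  then have parcs_H: "parcs H = (\<lambda>(u, v). (?k u, ?k v)) ` parcs G"
    unfolding aH by (intro image_cong) auto
  have adj: "(?k u, ?k v) \<in> parcs H \<longleftrightarrow> (u, v) \<in> parcs G" if "u \<in> pverts G" "v \<in> pverts G" for u v
  proof
    assume "(?k u, ?k v) \<in> parcs H"
    then obtain a b where ab: "(a, b) \<in> parcs G" "?k u = ?k a" "?k v = ?k b"
      using parcs_H by auto
    then have "u = a" "v = b"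
      using inj_onD[OF inj, of u a] inj_onD[OF inj, of v b] that G.in_arcsD1[of a b] G.in_arcsD2[of a b]
      by auto
    then show "(u, v) \<in> parcs G" using ab by simp
  next
    assume "(u, v) \<in> parcs G"
    then show "(?k u, ?k v) \<in> parcs H" using parcs_H by force
  qed
  let ?g = "inv_into (pverts G) ?k"
  have "bij_betw ?g (pverts H) (pverts G)"
    using inj pH by (intro bij_betw_inv_into) (simp add: bij_betw_def)
  moreover have "(?g i, ?g j) \<in> parcs G \<longleftrightarrow> (i, j) \<in> parcs H" if "i \<in> pverts H" "j \<in> pverts H" for i j
    using adj[of "?g i" "?g j"] that pH by (simp add: inv_into_into f_inv_into_f)
  ultimately show "\<exists>g. bij_betw g (pverts H) (pverts G) \<and>
      (\<forall>i\<in>pverts H. \<forall>j\<in>pverts H. (g i, g j) \<in> parcs G \<longleftrightarrow> (i, j) \<in> parcs H)" by blast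
next
  interpret G: pair_wf_digraph G by fact
  interpret H: pair_wf_digraph H by fact
  assume "\<exists>g. bij_betw g (pverts H) (pverts G) \<and>
      (\<forall>i\<in>pverts H. \<forall>j\<in>pverts H. (g i, g j) \<in> parcs G \<longleftrightarrow> (i, j) \<in> parcs H)"
  then obtain g where g: "bij_betw g (pverts H) (pverts G)"
    and adj: "\<And>i j. \<lbrakk>i \<in> pverts H; j \<in> pverts H\<rbrakk> \<Longrightarrow> (g i, g j) \<in> parcs G \<longleftrightarrow> (i, j) \<in> parcs H" by blast
  define k where "k = inv_into (pverts H) g"
  have k: "bij_betw k (pverts G) (pverts H)" unfolding k_def by (rule bij_betw_inv_into[OF g])
  have gk: "g (k u) = u" if "u \<in> pverts G" for u
    unfolding k_def by (rule bij_betw_inv_into_right[OF g that])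
  have kg: "k (g i) = i" if "i \<in> pverts H" for i
    unfolding k_def by (rule bij_betw_inv_into_left[OF g that])
  have gV: "g i \<in> pverts G" if "i \<in> pverts H" for i by (rule bij_betwE[OF g, rule_format, OF that])
  have kV: "k u \<in> pverts H" if "u \<in> pverts G" for u by (rule bij_betwE[OF k, rule_format, OF that])
  have kadj: "(k u, k v) \<in> parcs H \<longleftrightarrow> (u, v) \<in> parcs G" if "u \<in> pverts G" "v \<in> pverts G" for u v
    using adj[OF kV[OF that(1)] kV[OF that(2)]] gk that by simp
  define f :: "('a, 'a \<times> 'a, 'b, 'b \<times> 'b) digraph_isomorphism"
    where "f = \<lparr>iso_verts = k, iso_arcs = (\<lambda>(u, v). (k u, k v)), iso_head = snd, iso_tail = fst\<rparr>"
  have "inj_on (\<lambda>(u, v). (k u, k v)) (parcs G)"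
  proof (rule inj_onI, clarify)
    fix a b c d assume ab: "(a, b) \<in> parcs G" and cd: "(c, d) \<in> parcs G" and eq: "k a = k c" "k b = k d"
    have "a = c" using gk[OF G.in_arcsD1[OF ab]] gk[OF G.in_arcsD1[OF cd]] eq(1) by metis
    moreover have "b = d" using gk[OF G.in_arcsD2[OF ab]] gk[OF G.in_arcsD2[OF cd]] eq(2) by metis
    ultimately show "a = c \<and> b = d" ..
  qed
  moreover have "inj_on k (pverts G)" using k by (simp add: bij_betw_def)
  ultimately have "pre_digraph.digraph_isomorphism (with_proj G) f"
    using G.wf_digraph_axioms by (auto simp: G.digraph_isomorphism_def f_def)
  moreover have "parcs H = (\<lambda>(u, v). (k u, k v)) ` parcs G"
  proof (intro subset_antisym subrelI)
    fix i j assume ij: "(i, j) \<in> parcs H"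
    then have "i \<in> pverts H" "j \<in> pverts H" using H.in_arcsD1 H.in_arcsD2 by auto
    then show "(i, j) \<in> (\<lambda>(u, v). (k u, k v)) ` parcs G"
      using ij adj[of i j] kg by (intro image_eqI[of _ _ "(g i, g j)"]) auto
  next
    fix i j assume "(i, j) \<in> (\<lambda>(u, v). (k u, k v)) ` parcs G"
    then obtain u v where "(u, v) \<in> parcs G" "i = k u" "j = k v" by auto
    then show "(i, j) \<in> parcs H" using kadj[of u v] G.in_arcsD1[of u v] G.in_arcsD2[of u v] by simp
  qed
  then have "with_proj H = app_iso f (with_proj G)"
    using k by (simp add: app_iso_def with_proj_def f_def bij_betw_def)
  ultimately show "digraph_iso (with_proj G) (with_proj H)" by (auto simp: digraph_iso_def)
qed

lemma double_broom_eq: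
  assumes "p + 2 \<le> n"
  shows "double_broom n p = with_proj \<lparr>pverts = {..<n},
    parcs = {(i, j). i < n \<and> j < n \<and> broom_adj (n - p) (p div 2) i j}\<rparr>"
proof -
  define m where "m = n - p"
  have n: "n = m + p" and m: "2 \<le> m" using assms by (auto simp: m_def)
  have "double_broom n p = with_proj \<lparr>pverts =
      {..<m} \<union> insert 0 {m..<m + p div 2} \<union> insert (m - 1) {m + p div 2..<n},
    parcs = {(i, j). i < m \<and> j < m \<and> (j = Suc i \<or> i = Suc j)} \<union>
      ({0} \<times> {m..<m + p div 2} \<union> {m..<m + p div 2} \<times> {0}) \<union>
      ({m - 1} \<times> {m + p div 2..<n} \<union> {m + p div 2..<n} \<times> {m - 1})\<rparr>"
    by (simp add: double_broom_def union_def with_proj_def path_graph_def star_graph_def m_def)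
  also have "{..<m} \<union> insert 0 {m..<m + p div 2} \<union> insert (m - 1) {m + p div 2..<n} = {..<n}"
    using n m by auto
  also have "{(i, j). i < m \<and> j < m \<and> (j = Suc i \<or> i = Suc j)} \<union>
      ({0} \<times> {m..<m + p div 2} \<union> {m..<m + p div 2} \<times> {0}) \<union>
      ({m - 1} \<times> {m + p div 2..<n} \<union> {m + p div 2..<n} \<times> {m - 1})
    = {(i, j). i < n \<and> j < n \<and> broom_adj m (p div 2) i j}" (is "?A = ?B")
  proof -
    have "k < n" if "k < m \<or> k < m + p div 2 \<or> k = 0 \<or> k = m - 1" for k
      using that n m by linarith
    then have "(i, j) \<in> ?A \<longleftrightarrow> (i, j) \<in> ?B" for i j
      by (simp add: broom_adj_def) blast
    then show ?thesis unfolding set_eq_iff split_paired_All by (intro allI)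
  qed
  finally show ?thesis by (simp add: m_def)
qed

lemma triangle_path_eq:
  assumes "4 \<le> n"
  shows "triangle_path n = with_proj \<lparr>pverts = {..<n},
    parcs = {(i, j). i < n \<and> j < n \<and> triangle_path_adj n i j}\<rparr>"
proof -
  have "triangle_path n = with_proj \<lparr>pverts = {..<n - 2} \<union> {0, n - 2, n - 1},
    parcs = {(i, j). i < n - 2 \<and> j < n - 2 \<and> (j = Suc i \<or> i = Suc j)} \<union>
      {(i, j). i \<in> {0, n - 2, n - 1} \<and> j \<in> {0, n - 2, n - 1} \<and> i \<noteq> j}\<rparr>"
    by (simp add: triangle_path_def union_def with_proj_def path_graph_def complete_graph_def)
  also have "{..<n - 2} \<union> {0, n - 2, n - 1} = {..<n}" using assms by auto
  also have "{(i, j). i < n - 2 \<and> j < n - 2 \<and> (j = Suc i \<or> i = Suc j)} \<union>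
      {(i, j). i \<in> {0, n - 2, n - 1} \<and> j \<in> {0, n - 2, n - 1} \<and> i \<noteq> j}
    = {(i, j). i < n \<and> j < n \<and> triangle_path_adj n i j}"
    using assms by (auto simp: triangle_path_adj_def)
  finally show ?thesis .
qed

lemma digraph_iso_labelled_iff:
  assumes "pair_graph G"
  shows "digraph_iso (with_proj G) (with_proj \<lparr>pverts = {..<n}, parcs = {(i, j). i < n \<and> j < n \<and> D i j}\<rparr>)
    \<longleftrightarrow> (\<exists>g. bij_betw g {..<n} (pverts G) \<and> (\<forall>i<n. \<forall>j<n. (g i, g j) \<in> parcs G \<longleftrightarrow> D i j))"
proof -
  interpret pair_graph G by fact
  have "pair_wf_digraph \<lparr>pverts = {..<n}, parcs = {(i, j). i < n \<and> j < n \<and> D i j}\<rparr>"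
    by unfold_locales auto
  from digraph_iso_with_proj_iff[OF pair_wf_digraph this] show ?thesis
    by (simp add: Ball_def lessThan_iff cong: conj_cong)
qed

theorem theorem17:
  fixes G :: "'a pair_pre_digraph" and n p :: nat
  assumes "n \<ge> 4" and "1 \<le> p" and "p \<le> n - 2"
    and "pair_graph G" and "connected (with_proj G)"
    and "card (pverts G) = n"
    and "card (pendant_verts (with_proj G)) = p"
  shows "(p = 1 \<longrightarrow>
            real (num_connected_induced (with_proj G)) \<ge> ((real n)^2 + 3 * real n - 4) / 2
          \<and> (real (num_connected_induced (with_proj G)) = ((real n)^2 + 3 * real n - 4) / 2
              \<longleftrightarrow> digraph_iso (with_proj G) (triangle_path n)))
       \<and> (p \<noteq> 1 \<longrightarrow>
            real (num_connected_induced (with_proj G)) \<ge>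
              2 ^ p + (real n - real p - 1) * (2 ^ (p div 2) + 2 ^ ((p + 1) div 2)) + real p
                + (real n - real p - 1) * (real n - real p - 2) / 2
          \<and> (real (num_connected_induced (with_proj G)) =
              2 ^ p + (real n - real p - 1) * (2 ^ (p div 2) + 2 ^ ((p + 1) div 2)) + real p
                + (real n - real p - 1) * (real n - real p - 2) / 2
              \<longleftrightarrow> digraph_iso (with_proj G) (double_broom n p)))"
proof -
  interpret pair_graph G by fact
  let ?V = "pverts G"
  interpret A: simple_adjacency "\<lambda>x y. (x, y) \<in> parcs G"
    by (rule pair_graph_simple_adjacency) fact
  have V: "finite ?V" "A.conn ?V" "card ?V = n"
    using pair_finite_verts assms(5,6) by (simp_all add: connected_iff_conn[OF assms(4)])
  have pend: "card (A.pendants ?V) = p" using assms(7) by (simp add: pendant_verts_eq[OF assms(4)])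
  have pn: "p + 2 \<le> n" using assms by linarith
  define N where "N = card (A.conn_sets ?V)"
  have N: "num_connected_induced (with_proj G) = N"
    by (simp add: num_connected_induced_eq[OF assms(4)] N_def)
  have bound: "broom_bound n p =
      2 ^ p + (real n - real p - 1) * (2 ^ (p div 2) + 2 ^ ((p + 1) div 2)) + real p
        + (real n - real p - 1) * (real n - real p - 2) / 2"
    using pn by (simp add: broom_bound_def weighted_bound_def balanced_sum_def)
  have "broom_bound n p \<le> N \<and> (N = broom_bound n p \<longleftrightarrow> digraph_iso (with_proj G) (double_broom n p))"
  proof -
    have "broom_bound n p \<le> N" using A.broom_bound_le[OF V(1,2) _ pend] V(3) assms(1) by (simp add: N_def)
    moreover have "digraph_iso (with_proj G) (double_broom n p) \<longleftrightarrow> (\<exists>g. A.broom_labelling g n p ?V)"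
      unfolding double_broom_eq[OF pn] digraph_iso_labelled_iff[OF assms(4)] A.broom_labelling_def ..
    moreover have "(\<exists>g. A.broom_labelling g n p ?V) \<longleftrightarrow> N = broom_bound n p"
      using A.broom_equality[OF V(1,2) _ pend] A.broom_conn_sets[OF V(1) _ pn] V(3) assms(1) pn
      by (auto simp: N_def)
    ultimately show ?thesis by blast
  qed
  moreover have "((real n)^2 + 3 * real n - 4) / 2 \<le> N \<and>
      (N = ((real n)^2 + 3 * real n - 4) / 2 \<longleftrightarrow> digraph_iso (with_proj G) (triangle_path n))"
    if "p = 1"
  proof -
    have few: "card (A.pendants ?V) \<le> 1" using pend that by simp
    obtain v where v: "v \<in> ?V" "A.conn (?V - {v})" "v \<notin> A.pendants ?V"
      using A.ex_noncut_nonpendant[OF V(1,2) _ few] V(3) assms(1) by auto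
    have "?V \<noteq> {v}" using V(3) assms(1) by auto
    then obtain a b where ab: "a \<in> ?V" "b \<in> ?V" "a \<noteq> b" "(v, a) \<in> parcs G" "(v, b) \<in> parcs G"
      using A.two_nbrs_if_not_pendant[OF V(2) v(1) _ v(3)] by metis
    have le: "n * (n + 3) \<le> 2 * N + 4"
      using A.noncut_degree_two_bound(1)[OF V(1,2) v(1,2) ab] V(3) by (simp add: N_def)
    have "2 * N + 4 \<le> n * (n + 3) \<longleftrightarrow> (\<exists>x v. A.triangle_on x v ?V)"
      using A.triangle_if_few_conn_sets[OF V(1,2) _ few] A.triangle_conn_sets_le[OF V(1)] V(3) assms(1)
      by (auto simp: N_def)
    also have "\<dots> \<longleftrightarrow> digraph_iso (with_proj G) (triangle_path n)"
      unfolding triangle_path_eq[OF assms(1)] digraph_iso_labelled_iff[OF assms(4)]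
      by (rule A.triangle_on_iff_labelling[OF V(1,3) assms(1)])
    finally have iff: "2 * N + 4 \<le> n * (n + 3) \<longleftrightarrow> digraph_iso (with_proj G) (triangle_path n)" .
    have "real (n * (n + 3)) \<le> real (2 * N + 4)" using le by (simp only: of_nat_le_iff)
    moreover have "2 * N + 4 \<le> n * (n + 3) \<longleftrightarrow> real (2 * N + 4) \<le> real (n * (n + 3))"
      by (simp only: of_nat_le_iff)
    ultimately show ?thesis unfolding iff[symmetric] by (auto simp: power2_eq_square algebra_simps)
  qed
  ultimately show ?thesis unfolding N bound by blast
qed

end
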